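(* Let $\mathbb{B}^n\subset\mathbb{R}^n$ be the unit ball (with the Euclidean metric). If $\Phi$ is an $N$-function, then $H^k_\Phi(\mathbb{B}^n)=0$ for all $k=1,\dots,n$.
   Context: An $N$-function is a function $\Phi:\mathbb{R}\to[0,\infty)$ that is even and convex, with $\Phi(x)=0\iff x=0$, $\lim_{x\to0}\Phi(x)/x=0$ and $\lim_{x\to\infty}\Phi(x)/x=\infty$. For a Riemannian manifold $X$ of dimension $n$ with volume element $d\mu_X$, and a measurable $k$-form $\omega$ on $X$ with pointwise norm $|\omega(x)|$ (induced by the Riemannian scalar product on exterior forms on $T_xX$), put $\rho_\Phi(\omega)=\int_X\Phi(|\omega(x)|)\,d\mu_X$. Forms differing on a set of measure zero are identified. $L^\Phi(X,\Lambda^k)$ is the space of measurable $k$-forms $\omega$ with $\rho_\Phi(\alpha\omega)<\infty$ for some $\alpha>0$, endowed with the gauge norm $\|\omega\|_{(\Phi)}=\inf\{K>0:\rho_\Phi(\omega/K)\le1\}$; it is a Banach space. Weak differential: a locally integrable $(j+1)$-form $\theta$ is the (weak) differential $d\omega$ of a locally integrable $j$-form $\omega$ if $\int_U\omega\wedge du=(-1)^{j+1}\int_U\theta\wedge u$ for every orientable domain $U\subset\mathrm{Int}\,X$ and every smooth compactly supported $(n-j-1)$-form $u$ with support in $U$. The $L_\Phi$-cohomology is $H^k_\Phi(X)=Z^k_\Phi(X)/B^k_\Phi(X)$, where $Z^k_\Phi(X)=\{\omega\in L^\Phi(X,\Lambda^k): d\omega=0\}$ and $B^k_\Phi(X)=\{\omega\in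 L^\Phi(X,\Lambda^k):\omega=d\beta\text{ for some }\beta\in L^\Phi(X,\Lambda^{k-1})\}$. *)

theory Defs
  imports "HOL-Analysis.Analysis" "HOL-Algebra.Elementary_Groups"
begin

section \<open>N-functions\<close>

definition N_function :: "(real \<Rightarrow> real) \<Rightarrow> bool" where
  "N_function \<Phi> \<longleftrightarrow>
     (\<forall>x. 0 \<le> \<Phi> x) \<and>
     (\<forall>x. \<Phi> (- x) = \<Phi> x) \<and>
     convex_on UNIV \<Phi> \<and>
     (\<forall>x. \<Phi> x = 0 \<longleftrightarrow> x = 0) \<and>
     ((\<lambda>x. \<Phi> x / x) \<longlongrightarrow> 0) (at 0) \<and>
     filterlim (\<lambda>x. \<Phi> x / x) at_top at_top"


section \<open>Exterior forms on Euclidean space\<close>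

text \<open>
  The index type \<open>'n\<close> of the coordinates is linearly ordered. For
  \<open>I = {i\<^sub>1 < \<dots> < i\<^sub>k}\<close> write \<open>dx\<^sub>I = dx\<^sub>i\<^sub>1 \<and> \<dots> \<and> dx\<^sub>i\<^sub>k\<close>. An element \<open>\<alpha>\<close> of the type below
  stands for the exterior form \<open>\<Sum>\<^sub>I (\<alpha> $ I) dx\<^sub>I\<close>. The scalar product that the Euclidean metric
  induces on exterior forms makes the \<open>dx\<^sub>I\<close> orthonormal, so the pointwise norm of a form is
  the norm of the type.
\<close>

type_synonym 'n exterior = "real ^ ('n set)"
type_synonym 'n space = "real ^ 'n"
type_synonym 'n form = "'n space \<Rightarrow> 'n exterior"

definition exterior_power :: "nat \<Rightarrow> 'n::finite exterior set" where
  "exterior_power k = {\<alpha>. \<forall>I. card I \<noteq> k \<longrightarrow> \<alpha> $ I = 0}"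

text \<open>
  For disjoint \<open>I\<close>, \<open>J\<close> one has \<open>dx\<^sub>I \<and> dx\<^sub>J = (-1)\<^sup>m dx\<^sub>I\<^sub>\<union>\<^sub>J\<close>, where \<open>m\<close> is the number of pairs
  \<open>i \<in> I\<close>, \<open>j \<in> J\<close> that are out of order; for overlapping \<open>I\<close>, \<open>J\<close> the product is \<open>0\<close>.
\<close>

definition wedge :: "'n::{finite,linorder} exterior \<Rightarrow> 'n exterior \<Rightarrow> 'n exterior" where
  "wedge \<alpha> \<beta> =
     (\<chi> K. \<Sum>I\<in>Pow K. (-1) ^ card {(i, j). i \<in> I \<and> j \<in> K - I \<and> j < i} * \<alpha> $ I * \<beta> $ (K - I))"

definition dx :: "'n::finite \<Rightarrow> 'n exterior" where
  "dx i = axis {i} 1"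


section \<open>Smooth forms and the exterior derivative\<close>

primrec Ck :: "nat \<Rightarrow> ('a::real_normed_vector \<Rightarrow> 'b::real_normed_vector) \<Rightarrow> bool" where
  "Ck 0 f \<longleftrightarrow> continuous_on UNIV f"
| "Ck (Suc m) f \<longleftrightarrow>
     (\<forall>x. f differentiable (at x)) \<and> (\<forall>v. Ck m (\<lambda>x. frechet_derivative f (at x) v))"

definition smooth :: "('a::real_normed_vector \<Rightarrow> 'b::real_normed_vector) \<Rightarrow> bool" where
  "smooth f \<longleftrightarrow> (\<forall>m. Ck m f)"

text \<open>\<open>du = \<Sum>\<^sub>i dx\<^sub>i \<and> \<partial>\<^sub>i u\<close>\<close>

definition ext_deriv ::
    "'n form \<Rightarrow> 'n::{finite,linorder} form" where
  "ext_deriv u x = (\<Sum>i\<in>UNIV. wedge (dx i) (frechet_derivative u (at x) (axis i 1)))"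

text \<open>
  Test forms on an open set \<open>U\<close> are understood as extended by \<open>0\<close> to the whole space.
\<close>

definition test_form :: "nat \<Rightarrow> 'n space set \<Rightarrow> 'n::finite form \<Rightarrow> bool" where
  "test_form m U u \<longleftrightarrow>
     (\<forall>x. u x \<in> exterior_power m) \<and> smooth u \<and>
     compact (closure {x. u x \<noteq> 0}) \<and> closure {x. u x \<noteq> 0} \<subseteq> U"

text \<open>
  Integral of a form of top degree with respect to the standard orientation, given by
  \<open>dx\<^sub>1 \<and> \<dots> \<and> dx\<^sub>n\<close>.
\<close>

definition form_integral :: "'n space set \<Rightarrow> 'n::finite form \<Rightarrow> real" where
  "form_integral U \<omega> = (LINT x|lebesgue_on U. \<omega> x $ UNIV)"


section \<open>The weak differential\<close>

text \<open>
  A form on \<open>X\<close> is represented by a function on the whole space whose values outside \<open>X\<close> are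
  irrelevant.
\<close>

definition measurable_form ::
    "nat \<Rightarrow> 'n space set \<Rightarrow> 'n::finite form \<Rightarrow> bool" where
  "measurable_form k X \<omega> \<longleftrightarrow>
     (\<forall>x\<in>X. \<omega> x \<in> exterior_power k) \<and> \<omega> \<in> borel_measurable (lebesgue_on X)"

definition loc_integrable_form ::
    "nat \<Rightarrow> 'n space set \<Rightarrow> 'n::finite form \<Rightarrow> bool" where
  "loc_integrable_form k X \<omega> \<longleftrightarrow>
     measurable_form k X \<omega> \<and> (\<forall>K. compact K \<and> K \<subseteq> X \<longrightarrow> \<omega> absolutely_integrable_on K)"

text \<open>
  \<open>weak_diff j X \<omega> \<theta>\<close>: the \<open>(j+1)\<close>-form \<open>\<theta>\<close> is the weak differential of the \<open>j\<close>-form \<open>\<omega>\<close>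
  on \<open>X\<close>. Test forms have degree \<open>n - j - 1\<close>, so there are none when \<open>j \<ge> n\<close>.
  Every domain of Euclidean space is orientable, and reversing the orientation changes the sign
  of both integrals, so it suffices to use the standard orientation.
\<close>

definition weak_diff ::
    "nat \<Rightarrow> 'n space set \<Rightarrow> 'n form \<Rightarrow>
     'n::{finite,linorder} form \<Rightarrow> bool" where
  "weak_diff j X \<omega> \<theta> \<longleftrightarrow>
     loc_integrable_form j X \<omega> \<and> loc_integrable_form (j + 1) X \<theta> \<and>
     (\<forall>U m u. open U \<and> connected U \<and> U \<subseteq> interior X \<and>
        j + 1 + m = CARD('n) \<and> test_form m U u \<longrightarrow>
        form_integral U (\<lambda>x. wedge (\<omega> x) (ext_deriv u x)) =
        (-1) ^ (j + 1) * form_integral U (\<lambda>x. wedge (\<theta> x) (u x)))"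


section \<open>Orlicz spaces of forms and \<open>L\<^sub>\<Phi>\<close>-cohomology\<close>

definition modular ::
    "(real \<Rightarrow> real) \<Rightarrow> 'n space set \<Rightarrow> 'n::finite form \<Rightarrow> ennreal" where
  "modular \<Phi> X \<omega> = (\<integral>\<^sup>+ x. ennreal (\<Phi> (norm (\<omega> x))) \<partial>lebesgue_on X)"

definition LPhi ::
    "(real \<Rightarrow> real) \<Rightarrow> nat \<Rightarrow> 'n space set \<Rightarrow> 'n::finite form set" where
  "LPhi \<Phi> k X =
     {\<omega>. measurable_form k X \<omega> \<and> (\<exists>\<alpha>>0. modular \<Phi> X (\<lambda>x. \<alpha> *\<^sub>R \<omega> x) < \<infinity>)}"

definition ZPhi ::
    "(real \<Rightarrow> real) \<Rightarrow> nat \<Rightarrow> 'n space set \<Rightarrow>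
     'n::{finite,linorder} form set" where
  "ZPhi \<Phi> k X = {\<omega> \<in> LPhi \<Phi> k X. weak_diff k X \<omega> (\<lambda>x. 0)}"

fun BPhi ::
    "(real \<Rightarrow> real) \<Rightarrow> nat \<Rightarrow> 'n space set \<Rightarrow>
     'n::{finite,linorder} form set" where
  "BPhi \<Phi> 0 X = {\<omega> \<in> LPhi \<Phi> 0 X. AE x in lebesgue_on X. \<omega> x = 0}"
| "BPhi \<Phi> (Suc j) X = {\<omega> \<in> LPhi \<Phi> (Suc j) X. \<exists>\<beta> \<in> LPhi \<Phi> j X. weak_diff j X \<beta> \<omega>}"

text \<open>
  Elements of \<open>LPhi\<close> are functions rather than classes modulo equality almost everywhere.
  Since \<open>BPhi\<close> contains every measurable form that vanishes almost everywhere on \<open>X\<close>, the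
  quotient below performs this identification as well.
\<close>

definition ZPhi_group ::
    "(real \<Rightarrow> real) \<Rightarrow> nat \<Rightarrow> 'n space set \<Rightarrow>
     'n::{finite,linorder} form monoid" where
  "ZPhi_group \<Phi> k X =
     \<lparr>carrier = ZPhi \<Phi> k X, mult = (\<lambda>\<omega> \<eta> x. \<omega> x + \<eta> x), one = (\<lambda>x. 0)\<rparr>"

definition HPhi ::
    "(real \<Rightarrow> real) \<Rightarrow> nat \<Rightarrow> 'n space set \<Rightarrow>
     'n::{finite,linorder} form set monoid" where
  "HPhi \<Phi> k X = ZPhi_group \<Phi> k X Mod BPhi \<Phi> k X"

end

theory Submission
  imports Defs "HOL-Probability.Probability_Measure"
begin

text \<open>
  Let \<open>\<omega>\<close> be a weakly closed form of degree \<open>j + 1\<close> on the unit ball \<open>B\<close> with \<open>\<Phi>(\<alpha>|\<omega>|)\<close>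
  integrable. Its primitive is the one of the Poincare lemma, an integral over the segments
  that join a vertex \<open>y \<in> B\<close> to the points of \<open>B\<close>:
  \<open>\<beta>(x) = \<integral>\<^sub>0\<^sup>1 t\<^sup>j \<iota>\<^sub>x\<^sub>-\<^sub>y \<omega>(y + t (x - y)) dt\<close> (\<open>cone_primitive\<close>). Two points need an argument: that
  \<open>\<beta>\<close> lies in the Orlicz space, and that \<open>d\<beta> = \<omega>\<close> although \<open>\<omega>\<close> is closed only in the weak sense.

  The first point is settled by the choice of \<open>y\<close>. For a given vertex the integral may diverge,
  because the segments concentrate the values of \<open>\<omega>\<close> near \<open>y\<close>. On average over \<open>y\<close> it does not:
  in the double integral of \<open>F(y + t (x - y))\<close> over \<open>x, y \<in> B\<close> one substitutes in \<open>x\<close> if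
  \<open>t \<ge> 1/2\<close> and in \<open>y\<close> otherwise, so that the Jacobian is at most \<open>2\<^sup>n\<close> for all \<open>t\<close>
  (\<open>cone_average_le\<close>). Hence almost every \<open>y\<close> makes the integral over \<open>t\<close> and \<open>x\<close> finite
  (\<open>exists_good_base_point\<close>), and Jensen's inequality for the integral over \<open>t\<close> bounds the
  modular of \<open>\<beta>\<close> (\<open>cone_primitive_modular\<close>).

  For the second point everything is moved to the test form \<open>u\<close>, of degree \<open>m = n - j - 1\<close>. Since
  contraction is an antiderivation, \<open>\<integral> \<beta> \<and> du\<close> is, up to the sign \<open>(-1)\<^sup>j\<close>, the integral over \<open>t\<close>
  and \<open>x\<close> of \<open>t\<^sup>j \<omega>(y + t (x - y)) \<and> \<iota>\<^sub>x\<^sub>-\<^sub>y du(x)\<close>. Cartan's formula (\<open>interior_product_ext_deriv\<close>)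
  splits \<open>\<iota>\<^sub>x\<^sub>-\<^sub>y du\<close> into the Lie derivative of \<open>u\<close> along \<open>x - y\<close> and the differential of
  \<open>\<iota>\<^sub>x\<^sub>-\<^sub>y u\<close>. The differential contributes nothing: a dilation towards \<open>y\<close> keeps the support of the
  test form \<open>\<iota>\<^sub>x\<^sub>-\<^sub>y u\<close> inside the convex ball, so weak closedness applies
  (\<open>closed_interior_product\<close>). After the substitution \<open>z = y + t (x - y)\<close> the Lie derivative
  becomes the derivative in \<open>t\<close> of the pullback \<open>u\<^sub>t\<close> of \<open>u\<close> by the inverse dilation
  (\<open>has_derivative_shrunk\<close>), and the fundamental theorem of calculus leaves the boundary terms
  \<open>\<integral> \<omega> \<and> u\<^sub>\<epsilon> - \<integral> \<omega> \<and> u\<close> (\<open>integral_slice_from\<close>). The first one tends to \<open>0\<close> along a sequence of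
  \<open>\<epsilon>\<close>, again by the choice of \<open>y\<close> (\<open>shrunk_vanishes\<close>). Only smooth functions composed with
  dilations occur on the side of the test forms, so neither \<open>\<omega>\<close> nor \<open>u\<close> has to be regularised.

  Conversely exact forms are closed because \<open>ddu = 0\<close> for test forms \<open>u\<close>. Thus closed and
  exact forms coincide in every positive degree, and the quotient group is trivial.
\<close>

section \<open>Contraction and the wedge product\<close>

text \<open>
  The sign that arises when \<open>dx\<^sub>i\<close> is moved into its place among the factors \<open>dx\<^sub>j\<close>, \<open>j \<in> K\<close>;
  it is the same for \<open>K\<close> with and without \<open>i\<close>.
\<close>

definition koszul_sign :: "'n::{finite,linorder} \<Rightarrow> 'n set \<Rightarrow> real" where
  "koszul_sign i K = (-1) ^ card {j \<in> K. j < i}"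

text \<open>
  Contraction with the \<open>i\<close>-th coordinate vector, the adjoint of \<open>wedge (dx i)\<close> for the scalar
  product in which the \<open>dx\<^sub>I\<close> are orthonormal.
\<close>

definition contract :: "'n::{finite,linorder} \<Rightarrow> 'n exterior \<Rightarrow> 'n exterior" where
  "contract i \<alpha> = (\<chi> K. if i \<in> K then 0 else koszul_sign i K * \<alpha> $ insert i K)"

lemma koszul_sign_square [simp]: "koszul_sign i K * koszul_sign i K = 1"
  by (simp add: koszul_sign_def flip: power_add)

lemma koszul_sign_insert:
  assumes "i \<notin> K"
  shows "koszul_sign j (insert i K) = (if i < j then - 1 else 1) * koszul_sign j K"
proof (cases "i < j")
  case True
  have "{l \<in> insert i K. l < j} = insert i {l \<in> K. l < j}" using True by auto
  with assms True show ?thesis by (simp add: koszul_sign_def)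
next
  case False
  then have "{l \<in> insert i K. l < j} = {l \<in> K. l < j}" by auto
  with False show ?thesis by (simp add: koszul_sign_def)
qed

lemma koszul_sign_remove:
  assumes "i \<in> K"
  shows "koszul_sign j (K - {i}) = (if i < j then - 1 else 1) * koszul_sign j K"
  using koszul_sign_insert[of i "K - {i}" j] assms by (auto simp: insert_absorb)

lemma wedge_dx_nth:
  "wedge (dx i) \<alpha> $ K = (if i \<in> K then koszul_sign i K * \<alpha> $ (K - {i}) else 0)"
proof -
  let ?f = "\<lambda>I. (-1::real) ^ card {(a, b). a \<in> I \<and> b \<in> K - I \<and> b < a} * dx i $ I * \<alpha> $ (K - I)"
  have 0: "?f I = 0" if "I \<noteq> {i}" for I using that by (simp add: dx_def axis_def)
  have "{(a, b). a \<in> {i} \<and> b \<in> K - {i} \<and> b < a} = Pair i ` {j \<in> K. j < i}" by auto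
  then have "card {(a, b). a \<in> {i} \<and> b \<in> K - {i} \<and> b < a} = card {j \<in> K. j < i}"
    by (simp add: card_image inj_on_def)
  then have 1: "?f {i} = koszul_sign i K * \<alpha> $ (K - {i})"
    by (simp add: koszul_sign_def dx_def axis_def)
  have "wedge (dx i) \<alpha> $ K = (\<Sum>I\<in>Pow K. ?f I)" by (simp add: wedge_def)
  also have "\<dots> = (\<Sum>I\<in>Pow K \<inter> {{i}}. ?f I)"
    by (rule sum.mono_neutral_right) (use 0 in auto)
  also have "\<dots> = (if i \<in> K then ?f {i} else 0)"
    by (cases "i \<in> K") auto
  finally show ?thesis using 1 by simp
qed

lemma contract_nth: "contract i \<alpha> $ K = (if i \<in> K then 0 else koszul_sign i K * \<alpha> $ insert i K)"
  by (simp add: contract_def)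

text \<open>
  Removing \<open>i\<close> and \<open>j\<close> from an index set in the two possible orders gives the same set, and the
  smaller of the two indices is counted by the sign of the larger one only if it is removed last.
\<close>

lemma wedge_dx_anticommute: "wedge (dx i) (wedge (dx j) \<alpha>) = - wedge (dx j) (wedge (dx i) \<alpha>)"
proof (cases "i = j")
  case True
  then show ?thesis by (simp add: vec_eq_iff wedge_dx_nth)
next
  case False
  have "wedge (dx i) (wedge (dx j) \<alpha>) $ K = - wedge (dx j) (wedge (dx i) \<alpha>) $ K" for K
  proof (cases "i \<in> K \<and> j \<in> K")
    case True
    have "wedge (dx a) (wedge (dx b) \<alpha>) $ K
        = koszul_sign a K * (if a < b then - 1 else 1) * koszul_sign b K * \<alpha> $ (K - {i, j})"
      if "{a, b} = {i, j}" for a b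
    proof -
      have "a \<in> K" "b \<in> K - {a}" "K - {a} - {b} = K - {i, j}"
        using that True False by (auto simp: doubleton_eq_iff)
      then show ?thesis by (simp only: wedge_dx_nth koszul_sign_remove if_True mult.assoc)
    qed
    from this[OF refl] this[OF insert_commute] False show ?thesis by (auto simp: not_less)
  qed (use False in \<open>auto simp: wedge_dx_nth\<close>)
  then show ?thesis by (simp add: vec_eq_iff)
qed

text \<open>
  The canonical anticommutation relations. For \<open>i = j\<close> exactly one of the two summands survives
  in each coordinate, and its sign is a square. For distinct indices the two summands rearrange
  the index set in the same way with opposite signs. Cartan's formula below is a weighted sum of
  these relations.
\<close>

lemma contract_wedge_dx:
  "contract i (wedge (dx j) \<alpha>) + wedge (dx j) (contract i \<alpha>) = (if i = j then \<alpha> else 0)"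
proof (cases "i = j")
  case True
  have "(contract i (wedge (dx i) \<alpha>) + wedge (dx i) (contract i \<alpha>)) $ K = \<alpha> $ K" for K
    by (cases "i \<in> K")
      (auto simp: wedge_dx_nth contract_nth koszul_sign_insert koszul_sign_remove insert_absorb
        simp flip: mult.assoc)
  with True show ?thesis by (simp add: vec_eq_iff)
next
  case False
  have "(contract i (wedge (dx j) \<alpha>) + wedge (dx j) (contract i \<alpha>)) $ K = 0" for K
  proof (cases "i \<notin> K \<and> j \<in> K")
    case True
    have K: "insert i K - {j} = insert i (K - {j})" using False by blast
    have "contract i (wedge (dx j) \<alpha>) $ K
        = koszul_sign i K * ((if i < j then - 1 else 1) * koszul_sign j K) * \<alpha> $ insert i (K - {j})"
      using True False by (simp add: wedge_dx_nth contract_nth koszul_sign_insert K)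
    moreover have "wedge (dx j) (contract i \<alpha>) $ K
        = koszul_sign j K * ((if j < i then - 1 else 1) * koszul_sign i K) * \<alpha> $ insert i (K - {j})"
      using True False by (simp add: wedge_dx_nth contract_nth koszul_sign_remove)
    ultimately show ?thesis using False by (auto simp: not_less)
  qed (use False in \<open>auto simp: wedge_dx_nth contract_nth\<close>)
  with False show ?thesis by (simp add: vec_eq_iff)
qed

text \<open>
  The operator \<open>dx\<^sub>i \<and> \<iota>\<^sub>i\<close> is the projection onto the span of the \<open>dx\<^sub>I\<close> with \<open>i \<in> I\<close>, so the
  sum counts the elements of \<open>I\<close>.
\<close>

lemma sum_wedge_dx_contract:
  assumes "\<alpha> \<in> exterior_power m"
  shows "(\<Sum>i\<in>UNIV. wedge (dx i) (contract i \<alpha>)) = real m *\<^sub>R \<alpha>"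
proof -
  have "(\<Sum>i\<in>UNIV. wedge (dx i) (contract i \<alpha>) $ K) = real m * \<alpha> $ K" for K
  proof -
    have "(\<Sum>i\<in>UNIV. wedge (dx i) (contract i \<alpha>) $ K) = (\<Sum>i\<in>UNIV. if i \<in> K then \<alpha> $ K else 0)"
      by (rule sum.cong)
        (auto simp: wedge_dx_nth contract_nth koszul_sign_remove insert_absorb simp flip: mult.assoc)
    also have "\<dots> = real (card K) * \<alpha> $ K"
      by (simp add: sum.If_cases)
    finally show ?thesis using assms by (cases "card K = m") (auto simp: exterior_power_def)
  qed
  then show ?thesis by (simp add: vec_eq_iff)
qed

text \<open>
  The coefficient of the volume form, which is what the integral of a form sees.
\<close>

definition top_pairing :: "'n::{finite,linorder} exterior \<Rightarrow> 'n exterior \<Rightarrow> real" where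
  "top_pairing \<alpha> \<beta> = wedge \<alpha> \<beta> $ UNIV"

text \<open>
  The sign of the shuffle that lists first \<open>I\<close> and then its complement.
\<close>

definition shuffle_sign :: "'n::{finite,linorder} set \<Rightarrow> real" where
  "shuffle_sign I = (-1) ^ card {(i, j). i \<in> I \<and> j \<in> - I \<and> j < i}"

lemma top_pairing_sum: "top_pairing \<alpha> \<beta> = (\<Sum>I\<in>UNIV. shuffle_sign I * \<alpha> $ I * \<beta> $ (- I))"
  by (simp add: top_pairing_def wedge_def shuffle_sign_def Compl_eq_Diff_UNIV)

text \<open>
  A count of inversions. When \<open>i\<close> moves from the complement into \<open>I\<close>, the inversions \<open>(a, i)\<close> with
  \<open>i < a \<in> I\<close> disappear and the inversions \<open>(i, b)\<close> with \<open>b < i\<close> outside \<open>I\<close> appear. The former, together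
  with the elements of \<open>I\<close> below \<open>i\<close>, exhaust \<open>I\<close>.
\<close>

lemma shuffle_sign_insert:
  assumes "i \<notin> I"
  shows "shuffle_sign I * koszul_sign i I =
    (-1) ^ card I * shuffle_sign (insert i I) * koszul_sign i (- insert i I)"
proof -
  let ?X = "{(a, b). a \<in> I \<and> b \<in> - insert i I \<and> b < a}"
  have "{(a, b). a \<in> I \<and> b \<in> - I \<and> b < a} = ?X \<union> (\<lambda>a. (a, i)) ` {a \<in> I. i < a}"
    using assms by auto
  moreover have "card (?X \<union> (\<lambda>a. (a, i)) ` {a \<in> I. i < a}) = card ?X + card {a \<in> I. i < a}"
    by (subst card_Un_disjoint) (auto simp: card_image inj_on_def)
  ultimately have 1: "card {(a, b). a \<in> I \<and> b \<in> - I \<and> b < a} = card ?X + card {a \<in> I. i < a}"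
    by simp
  have "{(a, b). a \<in> insert i I \<and> b \<in> - insert i I \<and> b < a} = ?X \<union> Pair i ` {b \<in> - insert i I. b < i}"
    by auto
  moreover have "card (?X \<union> Pair i ` {b \<in> - insert i I. b < i})
      = card ?X + card {b \<in> - insert i I. b < i}"
    by (subst card_Un_disjoint) (use assms in \<open>auto simp: card_image inj_on_def\<close>)
  ultimately have 2: "card {(a, b). a \<in> insert i I \<and> b \<in> - insert i I \<and> b < a}
      = card ?X + card {b \<in> - insert i I. b < i}"
    by simp
  have "I = {a \<in> I. i < a} \<union> {a \<in> I. a < i}" using assms by auto (metis neqE)
  then have "card I = card ({a \<in> I. i < a} \<union> {a \<in> I. a < i})" by simp
  also have "\<dots> = card {a \<in> I. i < a} + card {a \<in> I. a < i}"
    by (rule card_Un_disjoint) auto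
  finally have 3: "card {a \<in> I. i < a} + card {a \<in> I. a < i} = card I" by simp
  have "shuffle_sign I * koszul_sign i I = (-1) ^ card ?X * (-1) ^ card I"
    unfolding shuffle_sign_def koszul_sign_def 1 3[symmetric] by (simp add: power_add)
  also have "\<dots> = (-1) ^ card I * (shuffle_sign (insert i I) * koszul_sign i (- insert i I))"
    unfolding shuffle_sign_def koszul_sign_def 2 by (simp add: power_add)
  finally show ?thesis by simp
qed

text \<open>
  Contraction is an antiderivation, and \<open>\<alpha> \<and> \<beta>\<close> vanishes if its degree exceeds \<open>n\<close>; hence a
  contraction may change sides at the price of a sign. In coordinates the term of \<open>I\<close> on the left
  corresponds to the term of \<open>insert i I\<close> on the right.
\<close>

lemma top_pairing_contract:
  assumes "\<alpha> \<in> exterior_power (Suc j)"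
  shows "top_pairing (contract i \<alpha>) \<beta> = (-1) ^ j * top_pairing \<alpha> (contract i \<beta>)"
proof -
  have "top_pairing (contract i \<alpha>) \<beta>
      = (\<Sum>I | i \<notin> I. shuffle_sign I * koszul_sign i I * \<alpha> $ insert i I * \<beta> $ (- I))"
    unfolding top_pairing_sum
    by (rule sum.mono_neutral_cong_right) (auto simp: contract_nth)
  also have "\<dots> = (\<Sum>I | i \<notin> I. (-1) ^ j * (shuffle_sign (insert i I) * \<alpha> $ insert i I *
      (koszul_sign i (- insert i I) * \<beta> $ (- I))))"
  proof (rule sum.cong)
    fix I assume "I \<in> {I. i \<notin> I}"
    then have i: "i \<notin> I" by simp
    show "shuffle_sign I * koszul_sign i I * \<alpha> $ insert i I * \<beta> $ (- I) =
      (-1) ^ j * (shuffle_sign (insert i I) * \<alpha> $ insert i I *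
      (koszul_sign i (- insert i I) * \<beta> $ (- I)))"
    proof (cases "card I = j")
      case True
      with shuffle_sign_insert[OF i] show ?thesis by (simp add: mult_ac)
    next
      case False
      with i have "card (insert i I) \<noteq> Suc j" by simp
      with assms have "\<alpha> $ insert i I = 0" by (simp add: exterior_power_def)
      then show ?thesis by simp
    qed
  qed simp
  also have "\<dots> = (\<Sum>J | i \<in> J. (-1) ^ j * (shuffle_sign J * \<alpha> $ J *
      (koszul_sign i (- J) * \<beta> $ insert i (- J))))"
    by (rule sum.reindex_bij_witness[of _ "\<lambda>J. J - {i}" "insert i"])
      (auto simp: insert_absorb intro!: arg_cong[where f = "\<lambda>K. \<beta> $ K"])
  also have "\<dots> = (-1) ^ j * top_pairing \<alpha> (contract i \<beta>)"
    unfolding top_pairing_sum sum_distrib_left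
    by (rule sum.mono_neutral_cong_left) (auto simp: contract_nth)
  finally show ?thesis .
qed

lemma bounded_bilinear_wedge: "bounded_bilinear (wedge :: 'n::{finite,linorder} exterior \<Rightarrow> _)"
proof -
  have "bilinear (wedge :: 'n exterior \<Rightarrow> 'n exterior \<Rightarrow> 'n exterior)"
    unfolding bilinear_def
    by (auto intro!: linearI simp: wedge_def vec_eq_iff algebra_simps sum.distrib sum_distrib_left)
  then show ?thesis by (simp add: bilinear_conv_bounded_bilinear)
qed


lemma linear_contract: "linear (contract i)"
  by (rule linearI) (auto simp: vec_eq_iff contract_nth algebra_simps)

definition interior_product :: "'n::{finite,linorder} space \<Rightarrow> 'n exterior \<Rightarrow> 'n exterior" where
  "interior_product v \<alpha> = (\<Sum>j\<in>UNIV. v $ j *\<^sub>R contract j \<alpha>)"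

lemma bounded_bilinear_interior_product:
  "bounded_bilinear (interior_product :: 'n::{finite,linorder} space \<Rightarrow> _)"
proof -
  have "bilinear (interior_product :: 'n space \<Rightarrow> _)"
    unfolding bilinear_def
    by (auto intro!: linearI simp: interior_product_def scaleR_left_distrib sum.distrib
        linear_add[OF linear_contract] linear_scale[OF linear_contract] scaleR_add_right
        scaleR_right.sum mult_ac)
  then show ?thesis by (simp add: bilinear_conv_bounded_bilinear)
qed

lemma bounded_bilinear_top_pairing:
  "bounded_bilinear (top_pairing :: 'n::{finite,linorder} exterior \<Rightarrow> _)"
proof -
  have "bilinear (top_pairing :: 'n exterior \<Rightarrow> 'n exterior \<Rightarrow> real)"
    unfolding bilinear_def
    by (auto intro!: linearI simp: top_pairing_sum algebra_simps sum.distrib sum_distrib_left)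
  then show ?thesis by (simp add: bilinear_conv_bounded_bilinear)
qed

lemma top_pairing_interior_product:
  assumes "\<alpha> \<in> exterior_power (Suc j)"
  shows "top_pairing (interior_product v \<alpha>) \<beta> = (-1) ^ j * top_pairing \<alpha> (interior_product v \<beta>)"
proof -
  interpret P: bounded_bilinear "top_pairing :: 'a exterior \<Rightarrow> _" by (rule bounded_bilinear_top_pairing)
  show ?thesis
    by (simp add: interior_product_def P.sum_left P.sum_right P.scaleR_left P.scaleR_right
      top_pairing_contract[OF assms] sum_distrib_left mult_ac)
qed

lemma contract_exterior_power:
  assumes "\<alpha> \<in> exterior_power (Suc j)"
  shows "contract i \<alpha> \<in> exterior_power j"
  using assms by (auto simp: exterior_power_def contract_nth)

lemma contract_exterior_power_0:
  assumes "\<alpha> \<in> exterior_power 0"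
  shows "contract i \<alpha> = 0"
  using assms by (auto simp: exterior_power_def contract_nth vec_eq_iff)

lemma wedge_dx_exterior_power:
  assumes "\<alpha> \<in> exterior_power j"
  shows "wedge (dx i) \<alpha> \<in> exterior_power (Suc j)"
proof -
  have "wedge (dx i) \<alpha> $ I = 0" if "card I \<noteq> Suc j" for I
  proof (cases "i \<in> I")
    case True
    then have "card (I - {i}) \<noteq> j" using that by (metis card.remove finite)
    with assms show ?thesis by (auto simp: exterior_power_def wedge_dx_nth)
  qed (simp add: wedge_dx_nth)
  then show ?thesis by (simp add: exterior_power_def)
qed

lemma subspace_exterior_power: "subspace (exterior_power k)"
  by (auto simp: subspace_def exterior_power_def)

lemma interior_product_exterior_power:
  assumes "\<alpha> \<in> exterior_power (Suc j)"
  shows "interior_product v \<alpha> \<in> exterior_power j"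
  unfolding interior_product_def
  by (intro subspace_sum subspace_scale subspace_exterior_power contract_exterior_power assms)

section \<open>Smooth maps\<close>

lemma Ck_continuous:
  assumes "Ck m f"
  shows "continuous_on UNIV f"
proof (cases m)
  case (Suc l)
  then have "f differentiable (at x)" for x using assms by simp
  then have "isCont f x" for x by (rule differentiable_imp_continuous_within)
  then show ?thesis by (intro continuous_at_imp_continuous_on) blast
qed (use assms in simp)

lemma Ck_mono_Suc: "Ck (Suc m) f \<Longrightarrow> Ck m f"
proof (induction m arbitrary: f)
  case 0
  show ?case using Ck_continuous[OF 0] by simp
next
  case (Suc m)
  have "Ck m (\<lambda>x. frechet_derivative f (at x) v)" for v
    using Suc.prems Ck.simps(2)[of "Suc m" f] by (intro Suc.IH) blast
  moreover have "\<forall>x. f differentiable (at x)"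
    using Suc.prems Ck.simps(2)[of "Suc m" f] by blast
  ultimately show ?case using Ck.simps(2)[of m f] by blast
qed

lemma frechet_derivativeI: "(f has_derivative f') (at x) \<Longrightarrow> frechet_derivative f (at x) = f'"
  by (rule frechet_derivative_at[symmetric])

lemma Ck_has_derivative:
  "Ck (Suc m) f \<Longrightarrow> (f has_derivative frechet_derivative f (at x)) (at x)"
  by (simp add: frechet_derivative_works)

lemma Ck_SucI:
  assumes "\<And>x. (f has_derivative f' x) (at x)" and "\<And>v. Ck m (\<lambda>x. f' x v)"
  shows "Ck (Suc m) f"
proof -
  have "frechet_derivative f (at x) = f' x" for x
    using assms(1) by (rule frechet_derivativeI)
  with assms show ?thesis by (auto simp: differentiable_def)
qed

lemma Ck_const: "Ck m (\<lambda>x. c)"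
  by (induction m arbitrary: c) (auto intro!: Ck_SucI derivative_eq_intros simp del: Ck.simps(2))

lemma Ck_bounded_linear:
  assumes "bounded_linear g"
  shows "Ck m g"
proof (cases m)
  case (Suc l)
  show ?thesis unfolding Suc
    by (rule Ck_SucI[OF bounded_linear_imp_has_derivative[OF assms] Ck_const])
qed (use assms in \<open>simp add: linear_continuous_on\<close>)

lemma Ck_compose_bounded_linear:
  assumes "bounded_linear g" "Ck m f"
  shows "Ck m (\<lambda>x. g (f x))"
  using assms(2)
proof (induction m arbitrary: f)
  case 0
  then show ?case using assms(1) by (auto intro: bounded_linear.continuous_on)
next
  case (Suc m)
  show ?case
  proof (rule Ck_SucI)
    show "((\<lambda>x. g (f x)) has_derivative (\<lambda>v. g (frechet_derivative f (at x) v))) (at x)" for x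
      using bounded_linear.has_derivative[OF assms(1) Ck_has_derivative[OF Suc.prems]] .
    show "Ck m (\<lambda>x. g (frechet_derivative f (at x) v))" for v
      using Suc by auto
  qed
qed

lemma Ck_add: "Ck m f \<Longrightarrow> Ck m g \<Longrightarrow> Ck m (\<lambda>x. f x + g x)"
proof (induction m arbitrary: f g)
  case (Suc m)
  show ?case
    by (rule Ck_SucI[OF has_derivative_add[OF Suc.prems[THEN Ck_has_derivative]]])
      (use Suc in auto)
qed (auto intro: continuous_on_add)

lemma Ck_sum: "(\<And>i. i \<in> A \<Longrightarrow> Ck m (f i)) \<Longrightarrow> Ck m (\<lambda>x. \<Sum>i\<in>A. f i x)"
  by (induction A rule: infinite_finite_induct) (auto intro: Ck_add Ck_const)

text \<open>
  The product rule expresses the derivative through products of a factor with a derivative of the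
  other one, so the induction also needs the factors themselves one order lower.
\<close>

lemma Ck_bounded_bilinear:
  assumes "bounded_bilinear h"
  shows "Ck m f \<Longrightarrow> Ck m g \<Longrightarrow> Ck m (\<lambda>x. h (f x) (g x))"
proof (induction m arbitrary: f g)
  case 0
  then show ?case by (auto intro: bounded_bilinear.continuous_on[OF assms])
next
  case (Suc m)
  show ?case
  proof (rule Ck_SucI)
    show "((\<lambda>x. h (f x) (g x)) has_derivative
      (\<lambda>v. h (f x) (frechet_derivative g (at x) v) + h (frechet_derivative f (at x) v) (g x))) (at x)" for x
      by (rule bounded_bilinear.FDERIV[OF assms Suc.prems[THEN Ck_has_derivative]])
    show "Ck m (\<lambda>x. h (f x) (frechet_derivative g (at x) v) + h (frechet_derivative f (at x) v) (g x))" for v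
      using Suc.prems Suc.IH Ck_mono_Suc[OF Suc.prems(1)] Ck_mono_Suc[OF Suc.prems(2)]
      by (auto intro!: Ck_add)
  qed
qed

lemma Ck_compose_affine:
  fixes f :: "'a::real_normed_vector \<Rightarrow> 'b::real_normed_vector"
  shows "Ck m f \<Longrightarrow> Ck m (\<lambda>x. f (a + c *\<^sub>R x))"
proof (induction m arbitrary: f)
  case 0
  then show ?case
    by (auto intro!: continuous_on_compose2[of UNIV f] continuous_intros)
next
  case (Suc m)
  show ?case
  proof (rule Ck_SucI)
    show "((\<lambda>x. f (a + c *\<^sub>R x)) has_derivative
        (\<lambda>v. frechet_derivative f (at (a + c *\<^sub>R x)) (c *\<^sub>R v))) (at x)" for x
      by (rule has_derivative_compose[of "\<lambda>x. a + c *\<^sub>R x" "\<lambda>v. c *\<^sub>R v", OF _ Ck_has_derivative[OF Suc.prems]])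
        (auto intro!: derivative_eq_intros)
    show "Ck m (\<lambda>x. frechet_derivative f (at (a + c *\<^sub>R x)) (c *\<^sub>R v))" for v
      using Suc.prems by (intro Suc.IH) auto
  qed
qed

lemma smooth_has_derivative:
  "smooth f \<Longrightarrow> (f has_derivative frechet_derivative f (at x)) (at x)"
  using Ck_has_derivative[of 0 f] by (auto simp: smooth_def)

lemma smooth_linear_derivative: "smooth f \<Longrightarrow> bounded_linear (frechet_derivative f (at x))"
  by (rule has_derivative_bounded_linear[OF smooth_has_derivative])

lemma smooth_continuous: "smooth f \<Longrightarrow> continuous_on UNIV f"
  by (auto simp: smooth_def dest: spec[of _ 0])

lemma smooth_directional_derivative:
  assumes "smooth f"
  shows "smooth (\<lambda>x. frechet_derivative f (at x) v)"
  using assms Ck.simps(2)[of _ f] unfolding smooth_def by blast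

lemma smooth_compose_bounded_linear:
  "bounded_linear g \<Longrightarrow> smooth f \<Longrightarrow> smooth (\<lambda>x. g (f x))"
  by (simp add: smooth_def Ck_compose_bounded_linear)

lemma smooth_sum: "(\<And>i. i \<in> A \<Longrightarrow> smooth (f i)) \<Longrightarrow> smooth (\<lambda>x. \<Sum>i\<in>A. f i x)"
  by (simp add: smooth_def Ck_sum)

lemma smooth_compose_affine:
  "smooth f \<Longrightarrow> smooth (\<lambda>x. f (a + c *\<^sub>R x))"
  by (simp add: smooth_def Ck_compose_affine)

lemma smooth_bounded_bilinear:
  "bounded_bilinear h \<Longrightarrow> smooth f \<Longrightarrow> smooth g \<Longrightarrow> smooth (\<lambda>x. h (f x) (g x))"
  by (simp add: smooth_def Ck_bounded_bilinear)

lemma smooth_affine: "smooth (\<lambda>x. x - (y::'a::real_normed_vector))"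
  using Ck_add[OF Ck_bounded_linear[OF bounded_linear_ident] Ck_const[of _ "- y"]] by (simp add: smooth_def)

section \<open>Symmetry of second derivatives\<close>

text \<open>
  The mean value theorem in direction \<open>a\<close>, applied to the increment of \<open>f\<close> in direction \<open>b\<close>, and
  then in direction \<open>b\<close>, applied to the derivative along \<open>a\<close>. The left-hand side is symmetric in
  \<open>a\<close> and \<open>b\<close>, which is what makes the lemma useful.
\<close>

lemma second_difference_mean_value:
  fixes f :: "'a::real_normed_vector \<Rightarrow> real"
  assumes "smooth f" "h > 0"
  obtains s t where "0 < s" "s < h" "0 < t" "t < h"
    "f (x + h *\<^sub>R a + h *\<^sub>R b) - f (x + h *\<^sub>R a) - f (x + h *\<^sub>R b) + f x
      = h * h * frechet_derivative (\<lambda>x. frechet_derivative f (at x) a) (at (x + s *\<^sub>R a + t *\<^sub>R b)) b"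
proof -
  let ?D = "\<lambda>x. frechet_derivative f (at x) a"
  let ?g = "\<lambda>s. f (x + s *\<^sub>R a + h *\<^sub>R b) - f (x + s *\<^sub>R a)"
  have line: "((\<lambda>s. F (p + s *\<^sub>R v)) has_real_derivative frechet_derivative F (at (p + s *\<^sub>R v)) v) (at s)"
    if "smooth F" for F :: "'a \<Rightarrow> real" and p v s
  proof -
    have "((\<lambda>s. F (p + s *\<^sub>R v)) has_derivative (\<lambda>r. frechet_derivative F (at (p + s *\<^sub>R v)) (r *\<^sub>R v))) (at s)"
      by (rule has_derivative_compose[of "\<lambda>s. p + s *\<^sub>R v" "\<lambda>r. r *\<^sub>R v", OF _ smooth_has_derivative[OF that]])
        (auto intro!: derivative_eq_intros)
    then show ?thesis
      by (simp add: has_field_derivative_def linear_scale[OF bounded_linear.linear[OF smooth_linear_derivative[OF that]]] mult_commute_abs)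
  qed
  have "(?g has_real_derivative (?D (x + s *\<^sub>R a + h *\<^sub>R b) - ?D (x + s *\<^sub>R a))) (at s)" for s
    using line[OF assms(1), of "x + h *\<^sub>R b" a s] line[OF assms(1), of x a s]
    by (intro DERIV_diff) (simp_all add: add_ac)
  from MVT2[OF assms(2) this] obtain s where s: "0 < s" "s < h"
    "?g h - ?g 0 = h * (?D (x + s *\<^sub>R a + h *\<^sub>R b) - ?D (x + s *\<^sub>R a))" by auto
  from MVT2[OF assms(2) line[OF smooth_directional_derivative[OF assms(1)]]]
  obtain t where t: "0 < t" "t < h"
    "?D (x + s *\<^sub>R a + h *\<^sub>R b) - ?D (x + s *\<^sub>R a)
       = h * frechet_derivative ?D (at (x + s *\<^sub>R a + t *\<^sub>R b)) b"
    by force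
  show ?thesis using that[OF s(1,2) t(1,2)] s(3) t(3) by simp
qed

text \<open>
  By the previous lemma the two iterated derivatives agree up to a change of the points of
  evaluation, and these points tend to \<open>x\<close> with the step width.
\<close>

lemma symmetric_derivative_real:
  fixes f :: "'a::real_normed_vector \<Rightarrow> real"
  assumes "smooth f"
  shows "frechet_derivative (\<lambda>x. frechet_derivative f (at x) a) (at x) b
       = frechet_derivative (\<lambda>x. frechet_derivative f (at x) b) (at x) a"
proof -
  let ?L = "\<lambda>a b x. frechet_derivative (\<lambda>x. frechet_derivative f (at x) a) (at x) b"
  have "\<exists>p q. norm (p - x) \<le> h * (norm a + norm b) \<and> norm (q - x) \<le> h * (norm a + norm b)
     \<and> ?L a b p = ?L b a q" if h: "h > 0" for h
  proof -
    have nb: "norm (s *\<^sub>R a + t *\<^sub>R b) \<le> h * (norm a + norm b)" if "0 < s" "s < h" "0 < t" "t < h" for s t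
      using that by (intro norm_triangle_le) (auto simp: distrib_left intro!: add_mono mult_right_mono)
    obtain s t where st: "0 < s" "s < h" "0 < t" "t < h"
      "f (x + h *\<^sub>R a + h *\<^sub>R b) - f (x + h *\<^sub>R a) - f (x + h *\<^sub>R b) + f x
        = h * h * ?L a b (x + s *\<^sub>R a + t *\<^sub>R b)"
      using second_difference_mean_value[OF assms h] by metis
    obtain t' s' where st': "0 < s'" "s' < h" "0 < t'" "t' < h"
      "f (x + h *\<^sub>R b + h *\<^sub>R a) - f (x + h *\<^sub>R b) - f (x + h *\<^sub>R a) + f x
        = h * h * ?L b a (x + t' *\<^sub>R b + s' *\<^sub>R a)"
      using second_difference_mean_value[OF assms h] by metis
    have "h * h * ?L a b (x + s *\<^sub>R a + t *\<^sub>R b) = h * h * ?L b a (x + t' *\<^sub>R b + s' *\<^sub>R a)"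
      unfolding st(5)[symmetric] st'(5)[symmetric] by (simp add: add_ac)
    then have "?L a b (x + s *\<^sub>R a + t *\<^sub>R b) = ?L b a (x + t' *\<^sub>R b + s' *\<^sub>R a)" using h by simp
    then show ?thesis using nb[OF st(1-4)] nb[OF st'(1-4)]
      by (intro exI[of _ "x + s *\<^sub>R a + t *\<^sub>R b"] exI[of _ "x + t' *\<^sub>R b + s' *\<^sub>R a"])
        (simp add: add_ac)
  qed
  then have "\<forall>n. \<exists>p q. norm (p - x) \<le> inverse (real (Suc n)) * (norm a + norm b)
     \<and> norm (q - x) \<le> inverse (real (Suc n)) * (norm a + norm b) \<and> ?L a b p = ?L b a q"
    by simp
  then obtain p q where pq: "\<And>n. norm (p n - x) \<le> inverse (real (Suc n)) * (norm a + norm b)"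
     "\<And>n. norm (q n - x) \<le> inverse (real (Suc n)) * (norm a + norm b)" "\<And>n. ?L a b (p n) = ?L b a (q n)"
    by metis
  have lim: "r \<longlonglongrightarrow> x" if "\<And>n. norm (r n - x) \<le> inverse (real (Suc n)) * (norm a + norm b)" for r
  proof -
    have "(\<lambda>n. inverse (real (Suc n)) * (norm a + norm b)) \<longlonglongrightarrow> 0"
      by (rule tendsto_mult_left_zero[OF LIMSEQ_inverse_real_of_nat])
    then have "(\<lambda>n. r n - x) \<longlonglongrightarrow> 0"
      by (rule Lim_null_comparison[OF always_eventually[OF allI[OF that]]])
    then show ?thesis by (simp add: LIM_zero_iff)
  qed
  have cont: "isCont (?L a b) x" for a b
    using smooth_continuous[OF smooth_directional_derivative[OF smooth_directional_derivative[OF assms]]]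
    by (simp add: continuous_on_eq_continuous_at)
  have "(\<lambda>n. ?L a b (p n)) \<longlonglongrightarrow> ?L a b x"
    by (rule isCont_tendsto_compose[OF cont lim[OF pq(1)]])
  moreover have "(\<lambda>n. ?L b a (q n)) \<longlonglongrightarrow> ?L b a x"
    by (rule isCont_tendsto_compose[OF cont lim[OF pq(2)]])
  ultimately show ?thesis unfolding pq(3) by (rule LIMSEQ_unique)
qed

lemma frechet_derivative_bounded_linear:
  assumes "bounded_linear g" "smooth f"
  shows "frechet_derivative (\<lambda>x. g (f x)) (at x) v = g (frechet_derivative f (at x) v)"
  by (simp add: frechet_derivativeI[OF bounded_linear.has_derivative[OF assms(1) smooth_has_derivative[OF assms(2)]]])

lemma symmetric_derivative:
  fixes f :: "'a::real_normed_vector \<Rightarrow> real ^ 'm"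
  assumes "smooth f"
  shows "frechet_derivative (\<lambda>x. frechet_derivative f (at x) a) (at x) b
       = frechet_derivative (\<lambda>x. frechet_derivative f (at x) b) (at x) a"
proof -
  have "frechet_derivative (\<lambda>x. frechet_derivative f (at x) a) (at x) b $ i
       = frechet_derivative (\<lambda>x. frechet_derivative f (at x) b) (at x) a $ i" for i
  proof -
    note nth = bounded_linear_vec_nth[of i]
    note D = frechet_derivative_bounded_linear[OF nth]
    show ?thesis
      using symmetric_derivative_real[OF smooth_compose_bounded_linear[OF nth assms], of a x b]
      by (simp add: D[OF assms] D[OF smooth_directional_derivative[OF assms]])
  qed
  then show ?thesis by (simp add: vec_eq_iff)
qed

section \<open>The exterior derivative\<close>

lemma bounded_linear_wedge: "bounded_linear (wedge \<alpha>)"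
  by (rule bounded_bilinear.bounded_linear_right[OF bounded_bilinear_wedge])

lemma smooth_ext_deriv: "smooth u \<Longrightarrow> smooth (ext_deriv u)"
  unfolding ext_deriv_def[abs_def]
  by (intro smooth_sum smooth_compose_bounded_linear[OF bounded_linear_wedge] smooth_directional_derivative)

lemma frechet_derivative_sum:
  assumes "finite A" "\<And>i. i \<in> A \<Longrightarrow> smooth (f i)"
  shows "frechet_derivative (\<lambda>x. \<Sum>i\<in>A. f i x) (at x) v = (\<Sum>i\<in>A. frechet_derivative (f i) (at x) v)"
  by (simp add: frechet_derivativeI[OF has_derivative_sum[OF smooth_has_derivative[OF assms(2)]]])

text \<open>
  Second derivatives are symmetric in the two directions, and \<open>dx\<^sub>i \<and> dx\<^sub>j\<close> is antisymmetric, so the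
  double sum is its own negative.
\<close>

lemma ext_deriv_ext_deriv:
  assumes "smooth u"
  shows "ext_deriv (ext_deriv u) x = 0"
proof -
  let ?D = "\<lambda>i j. frechet_derivative (\<lambda>x. frechet_derivative u (at x) (axis j 1)) (at x) (axis i 1)"
  let ?S = "\<Sum>i\<in>UNIV. \<Sum>j\<in>UNIV. wedge (dx i) (wedge (dx j) (?D i j))"
  note sm = smooth_compose_bounded_linear[OF bounded_linear_wedge smooth_directional_derivative[OF assms]]
  have "frechet_derivative (ext_deriv u) (at x) v
      = (\<Sum>j\<in>UNIV. wedge (dx j) (frechet_derivative (\<lambda>x. frechet_derivative u (at x) (axis j 1)) (at x) v))" for v
    unfolding ext_deriv_def[abs_def]
    by (simp add: frechet_derivative_sum[OF finite sm]
      frechet_derivative_bounded_linear[OF bounded_linear_wedge smooth_directional_derivative[OF assms]])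
  then have S: "ext_deriv (ext_deriv u) x = ?S"
    unfolding ext_deriv_def[of "ext_deriv u"]
    by (simp add: linear_sum[OF bounded_linear.linear[OF bounded_linear_wedge]])
  have "?S = (\<Sum>j\<in>UNIV. \<Sum>i\<in>UNIV. wedge (dx i) (wedge (dx j) (?D i j)))"
    by (rule sum.swap)
  also have "\<dots> = (\<Sum>j\<in>UNIV. \<Sum>i\<in>UNIV. - wedge (dx j) (wedge (dx i) (?D j i)))"
    by (intro sum.cong refl, subst wedge_dx_anticommute, subst symmetric_derivative[OF assms]) simp
  also have "\<dots> = - ?S" by (simp add: sum_negf)
  finally have "?S + ?S = 0" by simp
  then have "2 *\<^sub>R ?S = 0" by (simp add: scaleR_2)
  with S show ?thesis by simp
qed

lemma ext_deriv_compose_affine: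
  assumes "smooth u"
  shows "ext_deriv (\<lambda>x. u (a + c *\<^sub>R x)) x = c *\<^sub>R ext_deriv u (a + c *\<^sub>R x)"
proof -
  have "((\<lambda>x. u (a + c *\<^sub>R x)) has_derivative
        (\<lambda>v. frechet_derivative u (at (a + c *\<^sub>R x)) (c *\<^sub>R v))) (at x)"
    by (rule has_derivative_compose[of "\<lambda>x. a + c *\<^sub>R x" "\<lambda>v. c *\<^sub>R v", OF _ smooth_has_derivative[OF assms]])
        (auto intro!: derivative_eq_intros)
  from frechet_derivativeI[OF this] show ?thesis
    by (simp add: ext_deriv_def scaleR_sum_right
       linear_scale[OF bounded_linear.linear[OF smooth_linear_derivative[OF assms]]]
       linear_scale[OF bounded_linear.linear[OF bounded_linear_wedge]])
qed

section \<open>Cartan's formula\<close>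

text \<open>
  Cartan's formula \<open>\<iota>\<^sub>E d + d \<iota>\<^sub>E = L\<^sub>E\<close> for the field \<open>E = x - y\<close>, whose Lie derivative acts on a form
  of degree \<open>m\<close> as \<open>m + \<partial>\<^sub>E\<close>: the derivative of the coefficient \<open>x - y\<close> inside \<open>d \<iota>\<^sub>E u\<close> counts the
  degree, and the terms with derivatives of \<open>u\<close> combine by the anticommutation relations.
\<close>

lemma interior_product_ext_deriv:
  assumes "smooth u" "u x \<in> exterior_power m"
  shows "interior_product (x - y) (ext_deriv u x) =
    real m *\<^sub>R u x + frechet_derivative u (at x) (x - y)
      - ext_deriv (\<lambda>x. interior_product (x - y) (u x)) x"
proof -
  let ?D = "\<lambda>i. frechet_derivative u (at x) (axis i 1)"
  let ?e = "\<lambda>i. wedge (dx i)"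
  have "((\<lambda>x. interior_product (x - y) (u x)) has_derivative
      (\<lambda>v. interior_product (x - y) (frechet_derivative u (at x) v) + interior_product v (u x))) (at x)"
    by (rule bounded_bilinear.FDERIV[OF bounded_bilinear_interior_product _ smooth_has_derivative[OF assms(1)]])
      (auto intro!: derivative_eq_intros)
  note D = frechet_derivativeI[OF this]
  have axis: "interior_product (axis i 1) \<alpha> = contract i \<alpha>" for i and \<alpha> :: "'a exterior"
    by (simp add: interior_product_def axis_def if_distrib[of "\<lambda>r. r *\<^sub>R _"] sum.If_cases cong: if_cong)
  have wl: "linear (wedge \<alpha>)" for \<alpha> :: "'a exterior"
    by (rule bounded_linear.linear[OF bounded_linear_wedge])
  note e = linear_sum[OF wl] linear_add[OF wl] linear_scale[OF wl]
  have 1: "ext_deriv (\<lambda>x. interior_product (x - y) (u x)) x =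
      (\<Sum>i\<in>UNIV. \<Sum>j\<in>UNIV. (x - y) $ j *\<^sub>R ?e i (contract j (?D i))) + real m *\<^sub>R u x"
    unfolding ext_deriv_def D
    by (simp add: axis e sum.distrib sum_wedge_dx_contract[OF assms(2)]) (simp add: interior_product_def e)
  have "interior_product (x - y) (ext_deriv u x)
      = (\<Sum>i\<in>UNIV. \<Sum>j\<in>UNIV. (x - y) $ j *\<^sub>R contract j (?e i (?D i)))"
    unfolding interior_product_def ext_deriv_def
    by (simp add: linear_sum[OF linear_contract] scaleR_sum_right) (rule sum.swap)
  then have "interior_product (x - y) (ext_deriv u x) + ext_deriv (\<lambda>x. interior_product (x - y) (u x)) x
     = (\<Sum>i\<in>UNIV. \<Sum>j\<in>UNIV. (x - y) $ j *\<^sub>R (contract j (?e i (?D i)) + ?e i (contract j (?D i)))) + real m *\<^sub>R u x"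
    unfolding 1 by (simp add: sum.distrib scaleR_add_right)
  also have "(\<Sum>i\<in>UNIV. \<Sum>j\<in>UNIV. (x - y) $ j *\<^sub>R (contract j (?e i (?D i)) + ?e i (contract j (?D i))))
     = (\<Sum>i\<in>UNIV. (x - y) $ i *\<^sub>R ?D i)"
    unfolding contract_wedge_dx
    by (simp add: if_distrib[of "\<lambda>r. _ *\<^sub>R r"] sum.If_cases cong: if_cong)
  also have "\<dots> = frechet_derivative u (at x) (\<Sum>i\<in>UNIV. (x - y) $ i *\<^sub>R axis i 1)"
    by (simp add: linear_sum[OF bounded_linear.linear[OF smooth_linear_derivative[OF assms(1)]]]
      linear_scale[OF bounded_linear.linear[OF smooth_linear_derivative[OF assms(1)]]])
  also have "(\<Sum>i\<in>UNIV. (x - y) $ i *\<^sub>R axis i 1) = x - y"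
    using basis_expansion[of "x - y"] by (simp add: scalar_mult_eq_scaleR)
  finally show ?thesis by (simp add: algebra_simps)
qed

section \<open>Test forms\<close>

lemma test_form_smooth: "test_form m U u \<Longrightarrow> smooth u" by (simp add: test_form_def)

lemma test_form_degree: "test_form m U u \<Longrightarrow> u x \<in> exterior_power m" by (simp add: test_form_def)

lemma test_form_mono: "test_form m U u \<Longrightarrow> U \<subseteq> V \<Longrightarrow> test_form m V u"
  by (auto simp: test_form_def)

text \<open>
  Off its support a form vanishes on an open set, so its derivatives vanish there as well.
\<close>

lemma test_form_compact_support:
  assumes "test_form m U u"
  shows "\<exists>K. compact K \<and> K \<subseteq> U \<and>
    (\<forall>x. x \<notin> K \<longrightarrow> u x = 0 \<and> (\<forall>v. frechet_derivative u (at x) v = 0) \<and> ext_deriv u x = 0)"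
proof -
  define K where "K = closure {x. u x \<noteq> 0}"
  have K: "compact K" "K \<subseteq> U" using assms by (auto simp: test_form_def K_def)
  have 0: "u x = 0" if "x \<notin> K" for x
    using that closure_subset[of "{x. u x \<noteq> 0}"] unfolding K_def by blast
  have D: "frechet_derivative u (at x) = (\<lambda>v. 0)" if "x \<notin> K" for x
  proof (rule frechet_derivativeI)
    have "((\<lambda>_. 0) has_derivative (\<lambda>v. 0)) (at x)" by simp
    then show "(u has_derivative (\<lambda>v. 0)) (at x)"
      by (rule has_derivative_transform_within_open[where s = "- K"])
        (use that in \<open>simp_all add: 0 open_Compl compact_imp_closed[OF K(1)]\<close>)
  qed
  have "ext_deriv u x = 0" if "x \<notin> K" for x
    by (simp add: ext_deriv_def D[OF that] linear_0[OF bounded_linear.linear[OF bounded_linear_wedge]])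
  with K 0 D show ?thesis by auto
qed

lemma test_formI:
  assumes "\<And>x. u x \<in> exterior_power m" "smooth u" "compact K" "K \<subseteq> U" "\<And>x. x \<notin> K \<Longrightarrow> u x = 0"
  shows "test_form m U u"
proof -
  have "closure {x. u x \<noteq> 0} \<subseteq> K"
    using assms(3,5) by (intro closure_minimal) (auto simp: compact_imp_closed)
  moreover from this have "compact (closure {x. u x \<noteq> 0})"
    using compact_Int_closed[OF assms(3) closed_closure, of "{x. u x \<noteq> 0}"] by (simp add: Int_absorb1)
  ultimately show ?thesis using assms unfolding test_form_def by blast
qed

lemma test_form_ext_deriv:
  assumes "test_form m U u"
  shows "test_form (Suc m) U (ext_deriv u)"
proof -
  obtain K where K: "compact K" "K \<subseteq> U" "\<And>x. x \<notin> K \<Longrightarrow> u x = 0"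
    "\<And>x v. x \<notin> K \<Longrightarrow> frechet_derivative u (at x) v = 0" "\<And>x. x \<notin> K \<Longrightarrow> ext_deriv u x = 0"
    using test_form_compact_support[OF assms] by metis
  have sub: "u x \<in> exterior_power m" for x by (rule test_form_degree[OF assms])
  have "frechet_derivative u (at x) v \<in> exterior_power m" for x v
  proof -
    have "frechet_derivative u (at x) v $ I = 0" if "card I \<noteq> m" for I
    proof -
      have "(\<lambda>x. u x $ I) = (\<lambda>x. 0)" using sub that by (auto simp: exterior_power_def)
      then show ?thesis
        using frechet_derivative_bounded_linear[OF bounded_linear_vec_nth[of I] test_form_smooth[OF assms], of x v]
        by simp
    qed
    then show ?thesis by (simp add: exterior_power_def)
  qed
  then have "ext_deriv u x \<in> exterior_power (Suc m)" for x
    unfolding ext_deriv_def by (intro subspace_sum subspace_exterior_power wedge_dx_exterior_power)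
  then show ?thesis
    by (rule test_formI[OF _ smooth_ext_deriv[OF test_form_smooth[OF assms]] K(1,2,5)])
qed

lemma test_form_interior_product:
  assumes "test_form (Suc m) U u"
  shows "test_form m U (\<lambda>x. interior_product (x - y) (u x))"
proof -
  obtain K where K: "compact K" "K \<subseteq> U" "\<And>x. x \<notin> K \<Longrightarrow> u x = 0"
    "\<And>x v. x \<notin> K \<Longrightarrow> frechet_derivative u (at x) v = 0" "\<And>x. x \<notin> K \<Longrightarrow> ext_deriv u x = 0"
    using test_form_compact_support[OF assms] by metis
  show ?thesis
    by (rule test_formI[OF _ _ K(1,2)])
      (auto simp: K(3) bounded_bilinear.zero_right[OF bounded_bilinear_interior_product]
       intro!: interior_product_exterior_power test_form_degree[OF assms] smooth_affine
         smooth_bounded_bilinear[OF bounded_bilinear_interior_product] test_form_smooth[OF assms])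
qed

text \<open>
  The support of the dilated form is the image of the support of \<open>u\<close> under
  \<open>x \<mapsto> (1 - t) y + t x\<close>, which stays in \<open>U\<close> by convexity.
\<close>

lemma test_form_dilate:
  fixes u :: "'n::{finite,linorder} form"
  assumes "test_form m U u" "convex U" "y \<in> U" "0 < t" "t \<le> 1"
  shows "test_form m U (\<lambda>z. u ((y - (1 / t) *\<^sub>R y) + (1 / t) *\<^sub>R z))"
proof -
  obtain K where K: "compact K" "K \<subseteq> U" "\<And>x. x \<notin> K \<Longrightarrow> u x = 0"
    "\<And>x v. x \<notin> K \<Longrightarrow> frechet_derivative u (at x) v = 0" "\<And>x. x \<notin> K \<Longrightarrow> ext_deriv u x = 0"
    using test_form_compact_support[OF assms(1)] by metis
  let ?\<phi> = "\<lambda>x. (1 - t) *\<^sub>R y + t *\<^sub>R x"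
  have inv: "?\<phi> (y - (1 / t) *\<^sub>R y + (1 / t) *\<^sub>R z) = z" for z
    using assms(4) by (simp add: algebra_simps)
  show ?thesis
  proof (rule test_formI)
    show "compact (?\<phi> ` K)" by (intro compact_continuous_image continuous_intros K)
    show "?\<phi> ` K \<subseteq> U" using K(2) assms by (auto intro!: convexD[OF assms(2)])
    show "u (y - (1 / t) *\<^sub>R y + (1 / t) *\<^sub>R z) = 0" if "z \<notin> ?\<phi> ` K" for z
      by (rule K(3)) (use that inv[of z] in \<open>metis imageI\<close>)
  qed (auto intro: test_form_degree[OF assms(1)] smooth_compose_affine test_form_smooth[OF assms(1)])
qed

section \<open>N-functions\<close>

lemma N_function_nonneg: "N_function \<Phi> \<Longrightarrow> 0 \<le> \<Phi> x"
  by (simp add: N_function_def)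

lemma N_function_zero: "N_function \<Phi> \<Longrightarrow> \<Phi> 0 = 0"
  by (simp add: N_function_def)

lemma N_function_convex: "N_function \<Phi> \<Longrightarrow> convex_on UNIV \<Phi>"
  by (simp add: N_function_def)

lemma N_function_measurable: "N_function \<Phi> \<Longrightarrow> \<Phi> \<in> borel_measurable borel"
  using convex_on_continuous[OF open_UNIV N_function_convex]
  by (intro borel_measurable_continuous_onI) simp

lemma N_function_scale:
  assumes "N_function \<Phi>" "0 \<le> s" "s \<le> 1"
  shows "\<Phi> (s * x) \<le> s * \<Phi> x"
  using convex_onD[OF N_function_convex[OF assms(1)], of s 0 x] assms by (simp add: N_function_zero)

lemma N_function_mono:
  assumes "N_function \<Phi>" "0 \<le> x" "x \<le> y"
  shows "\<Phi> x \<le> \<Phi> y"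
proof (cases "y = 0")
  case False
  with assms have y: "y > 0" by simp
  have "\<Phi> x = \<Phi> (x / y * y)" using y by simp
  also have "\<dots> \<le> x / y * \<Phi> y"
    by (rule N_function_scale) (use assms y in auto)
  also have "\<dots> \<le> 1 * \<Phi> y"
    by (rule mult_right_mono) (use assms y N_function_nonneg in auto)
  finally show ?thesis by simp
qed (use assms in simp)

text \<open>
  Through this bound integrability of \<open>\<Phi>(\<alpha>|\<omega>|)\<close> on a set of finite measure implies integrability
  of \<open>\<omega>\<close>.
\<close>

lemma N_function_superlinear:
  assumes "N_function \<Phi>"
  obtains R where "0 \<le> R" "\<And>s. 0 \<le> s \<Longrightarrow> s \<le> R + \<Phi> s"
proof -
  have "filterlim (\<lambda>x. \<Phi> x / x) at_top at_top" using assms by (simp add: N_function_def)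
  then have "\<forall>\<^sub>F x in at_top. 1 \<le> \<Phi> x / x" by (simp add: filterlim_at_top)
  then obtain N where N: "\<And>x. N \<le> x \<Longrightarrow> 1 \<le> \<Phi> x / x" by (auto simp: eventually_at_top_linorder)
  have "s \<le> max N 1 + \<Phi> s" if "0 \<le> s" for s
  proof (cases "max N 1 \<le> s")
    case True
    then have "0 < s" by simp
    moreover have "1 \<le> \<Phi> s / s" by (rule N) (use True in simp)
    ultimately show ?thesis by (simp add: field_simps)
  next
    case False
    then show ?thesis using N_function_nonneg[OF assms, of s] by linarith
  qed
  then show ?thesis using that[of "max N 1"] by simp
qed

text \<open>
  The factor \<open>2\<close> remains inside \<open>\<Phi>\<close> because \<open>\<Phi>\<close> may grow arbitrarily fast; in the Orlicz space it
  is absorbed by the free scaling constant.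
\<close>

lemma N_function_norm_add:
  assumes "N_function \<Phi>"
  shows "\<Phi> (norm (a + b)) \<le> \<Phi> (norm (2 *\<^sub>R a)) + \<Phi> (norm (2 *\<^sub>R b))"
proof -
  have "norm (a + b) \<le> norm (2 *\<^sub>R a) \<or> norm (a + b) \<le> norm (2 *\<^sub>R b)"
    using norm_triangle_ineq[of a b] by auto
  then have "\<Phi> (norm (a + b)) \<le> \<Phi> (norm (2 *\<^sub>R a)) \<or> \<Phi> (norm (a + b)) \<le> \<Phi> (norm (2 *\<^sub>R b))"
    using N_function_mono[OF assms norm_ge_zero] by blast
  then show ?thesis
    using N_function_nonneg[OF assms, of "norm (2 *\<^sub>R a)"] N_function_nonneg[OF assms, of "norm (2 *\<^sub>R b)"]
    by linarith
qed

text \<open>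
  For \<open>g\<close> that is not integrable the Bochner integral is \<open>0\<close> by convention, and so is the left-hand
  side. This makes the inequality applicable to \<open>cone_primitive\<close> at every point.
\<close>

lemma (in prob_space) N_function_jensen:
  fixes g :: "'a \<Rightarrow> 'b::{banach, second_countable_topology}"
  assumes N: "N_function \<Phi>" and g[measurable]: "g \<in> borel_measurable M"
  shows "ennreal (\<Phi> (norm (\<integral>t. g t \<partial>M))) \<le> (\<integral>\<^sup>+t. ennreal (\<Phi> (norm (g t))) \<partial>M)"
proof (cases "integrable M g \<and> (\<integral>\<^sup>+t. ennreal (\<Phi> (norm (g t))) \<partial>M) < \<infinity>")
  case True
  note [measurable] = N_function_measurable[OF N]
  have nn: "0 \<le> \<Phi> s" for s by (rule N_function_nonneg[OF N])
  have i: "integrable M (\<lambda>t. \<Phi> (norm (g t)))"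
    by (rule integrableI_nonneg) (use True nn in auto)
  have "\<Phi> (norm (\<integral>t. g t \<partial>M)) \<le> \<Phi> (\<integral>t. norm (g t) \<partial>M)"
    by (rule N_function_mono[OF N norm_ge_zero integral_norm_bound])
  also have "\<dots> \<le> (\<integral>t. \<Phi> (norm (g t)) \<partial>M)"
    by (rule jensens_inequality[where I = UNIV]) (use True i N_function_convex[OF N] in auto)
  finally show ?thesis
    using nn_integral_eq_integral[OF i] nn by (simp add: ennreal_leI)
next
  case False
  then show ?thesis
    using N_function_zero[OF N] by (auto simp: not_integrable_integral_eq less_top[symmetric])
qed

section \<open>Dilations\<close>

lemma nn_integral_lborel_affine:
  fixes F :: "'a::euclidean_space \<Rightarrow> ennreal"
  assumes [measurable]: "F \<in> borel_measurable borel" and "c > 0"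
  shows "(\<integral>\<^sup>+x. F x \<partial>lborel) = ennreal (c ^ DIM('a)) * (\<integral>\<^sup>+x. F (a + c *\<^sub>R x) \<partial>lborel)"
  by (subst lborel_affine[of c a])
    (use assms in \<open>simp_all add: nn_integral_density nn_integral_distr nn_integral_cmult\<close>)

lemma integral_lborel_affine:
  fixes f :: "'a::euclidean_space \<Rightarrow> real"
  assumes [measurable]: "f \<in> borel_measurable borel" and "c > 0"
  shows "(\<integral>x. f x \<partial>lborel) = c ^ DIM('a) * (\<integral>x. f (a + c *\<^sub>R x) \<partial>lborel)"
  by (subst lborel_affine[of c a])
    (use assms in \<open>simp_all add: integral_density integral_distr\<close>)

text \<open>
  The Jacobian \<open>c\<close> to the power \<open>-n\<close> of the substitution is at most \<open>2\<^sup>n\<close>.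
\<close>

lemma nn_integral_lborel_affine_le:
  fixes F :: "'a::euclidean_space \<Rightarrow> ennreal"
  assumes F: "F \<in> borel_measurable borel" and "c \<ge> 1 / 2"
  shows "(\<integral>\<^sup>+x. F (a + c *\<^sub>R x) \<partial>lborel) \<le> ennreal (2 ^ DIM('a)) * (\<integral>\<^sup>+x. F x \<partial>lborel)"
proof -
  let ?J = "\<integral>\<^sup>+x. F (a + c *\<^sub>R x) \<partial>lborel"
  have "1 \<le> (2 * c) ^ DIM('a)" using assms(2) by (intro one_le_power) simp
  then have "1 * ?J \<le> ennreal ((2 * c) ^ DIM('a)) * ?J"
    by (intro mult_right_mono) simp_all
  also have "\<dots> = ennreal (2 ^ DIM('a)) * (ennreal (c ^ DIM('a)) * ?J)"
    using assms(2) by (simp add: power_mult_distrib ennreal_mult mult.assoc)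
  also have "ennreal (c ^ DIM('a)) * ?J = (\<integral>\<^sup>+x. F x \<partial>lborel)"
    by (rule nn_integral_lborel_affine[symmetric]) (use assms in auto)
  finally show ?thesis by simp
qed

section \<open>Averaging over the vertex of a cone\<close>

text \<open>
  Lebesgue measure on \<open>(0, 1]\<close>, as a measure on the Borel sets of the whole line: it is a
  probability measure, as Jensen's inequality requires, and functions of \<open>t\<close> need no restriction.
  The end point \<open>1\<close> is included so that the truncation to \<open>[\<epsilon>, 1]\<close> below lies in it.
\<close>

definition unit_interval :: "real measure" where
  "unit_interval = density lborel (\<lambda>t. ennreal (indicator {0<..1} t))"

lemma sets_unit_interval [simp, measurable_cong]: "sets unit_interval = sets borel"
  by (simp add: unit_interval_def)

lemma space_unit_interval [simp]: "space unit_interval = UNIV"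
  by (simp add: unit_interval_def)

lemma prob_space_unit_interval: "prob_space unit_interval"
proof
  have "emeasure unit_interval UNIV = (\<integral>\<^sup>+t. indicator {0<..1::real} t \<partial>lborel)"
    unfolding unit_interval_def by (subst emeasure_density) (auto simp: ennreal_indicator)
  then show "emeasure unit_interval (space unit_interval) = 1" by simp
qed

lemma AE_unit_interval: "AE t in unit_interval. 0 < t \<and> t \<le> 1"
  unfolding unit_interval_def by (subst AE_density) (auto intro!: AE_I2 split: split_indicator_asm)

text \<open>
  In \<open>(1 - t) y + t x\<close> one of the two weights is at least \<open>1/2\<close>. The substitution in the variable
  with that weight gives a bound that is uniform in \<open>t\<close>, whereas the integral over \<open>x\<close> alone may
  blow up as \<open>t \<rightarrow> 0\<close>.
\<close>

lemma cone_average_le: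
  fixes F :: "'a::euclidean_space \<Rightarrow> ennreal"
  assumes [measurable]: "F \<in> borel_measurable borel" and S[measurable]: "S \<in> sets borel"
    and t: "0 < t" "t \<le> 1"
  shows "(\<integral>\<^sup>+y. (\<integral>\<^sup>+x. F (y + t *\<^sub>R (x - y)) * indicator S x \<partial>lborel) * indicator S y \<partial>lborel)
    \<le> ennreal (2 ^ DIM('a)) * (\<integral>\<^sup>+x. F x \<partial>lborel) * emeasure lborel S"
proof -
  let ?C = "ennreal (2 ^ DIM('a)) * (\<integral>\<^sup>+x. F x \<partial>lborel)"
  have C: "(\<integral>\<^sup>+y. ?C * indicator S y \<partial>lborel) = ?C * emeasure lborel S"
    by (simp add: nn_integral_cmult_indicator)
  show ?thesis
  proof (cases "1 / 2 \<le> t")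
    case True
    have "(\<integral>\<^sup>+x. F (y + t *\<^sub>R (x - y)) * indicator S x \<partial>lborel) \<le> ?C" for y
    proof -
      have "(\<integral>\<^sup>+x. F (y + t *\<^sub>R (x - y)) * indicator S x \<partial>lborel)
          \<le> (\<integral>\<^sup>+x. F ((y - t *\<^sub>R y) + t *\<^sub>R x) \<partial>lborel)"
        by (intro nn_integral_mono) (auto simp: algebra_simps split: split_indicator)
      also have "\<dots> \<le> ?C" using True by (intro nn_integral_lborel_affine_le) auto
      finally show ?thesis .
    qed
    then show ?thesis unfolding C[symmetric] by (intro nn_integral_mono mult_right_mono) simp_all
  next
    case False
    have *: "(\<integral>\<^sup>+y. F (y + t *\<^sub>R (x - y)) * indicator S y \<partial>lborel) \<le> ?C" for x
    proof -
      have "(\<integral>\<^sup>+y. F (y + t *\<^sub>R (x - y)) * indicator S y \<partial>lborel)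
          \<le> (\<integral>\<^sup>+y. F (t *\<^sub>R x + (1 - t) *\<^sub>R y) \<partial>lborel)"
        by (intro nn_integral_mono) (auto simp: algebra_simps split: split_indicator)
      also have "\<dots> \<le> ?C" using False by (intro nn_integral_lborel_affine_le) auto
      finally show ?thesis .
    qed
    have "(\<integral>\<^sup>+y. (\<integral>\<^sup>+x. F (y + t *\<^sub>R (x - y)) * indicator S x \<partial>lborel) * indicator S y \<partial>lborel)
       = (\<integral>\<^sup>+y. (\<integral>\<^sup>+x. F (y + t *\<^sub>R (x - y)) * indicator S x * indicator S y \<partial>lborel) \<partial>lborel)"
      by (simp add: nn_integral_multc)
    also have "\<dots> = (\<integral>\<^sup>+x. (\<integral>\<^sup>+y. F (y + t *\<^sub>R (x - y)) * indicator S x * indicator S y \<partial>lborel) \<partial>lborel)"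
      by (rule lborel_pair.Fubini') simp
    also have "\<dots> = (\<integral>\<^sup>+x. (\<integral>\<^sup>+y. F (y + t *\<^sub>R (x - y)) * indicator S y \<partial>lborel) * indicator S x \<partial>lborel)"
      by (intro nn_integral_cong, subst nn_integral_multc[symmetric]) (auto intro!: nn_integral_cong simp: mult_ac)
    also have "\<dots> \<le> (\<integral>\<^sup>+x. ?C * indicator S x \<partial>lborel)"
      using * by (intro nn_integral_mono mult_right_mono) simp_all
    finally show ?thesis unfolding C .
  qed
qed

text \<open>
  Both conditions follow from the uniform bound on the average over \<open>y\<close>. For the first, integrate
  it over \<open>t\<close>. For the second, sum it over the values \<open>t = 4\<^sup>-\<^sup>i\<close> with the weights \<open>2\<^sup>-\<^sup>i\<close>. Almost
  every \<open>y\<close> makes the resulting integral and sum finite. In the second condition the growth \<open>2\<^sup>i\<close>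
  is slower than that of \<open>1/t = 4\<^sup>i\<close>, and this difference makes the boundary term vanish in
  \<open>shrunk_vanishes\<close>.
\<close>

lemma exists_good_base_point:
  fixes F :: "'a::euclidean_space \<Rightarrow> ennreal"
  assumes F[measurable]: "F \<in> borel_measurable borel" and fin: "(\<integral>\<^sup>+x. F x \<partial>lborel) < \<infinity>"
    and S[measurable]: "S \<in> sets borel" and S0: "emeasure lborel S \<noteq> 0" and S1: "emeasure lborel S < \<infinity>"
  shows "\<exists>y\<in>S. \<exists>M\<ge>0.
    (\<integral>\<^sup>+t. (\<integral>\<^sup>+x. F (y + t *\<^sub>R (x - y)) * indicator S x \<partial>lborel) \<partial>unit_interval) < \<infinity> \<and>
    (\<forall>i. (\<integral>\<^sup>+x. F (y + (1 / 4) ^ i *\<^sub>R (x - y)) * indicator S x \<partial>lborel) \<le> ennreal (2 ^ i * M))"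
proof -
  interpret U: prob_space unit_interval by (rule prob_space_unit_interval)
  interpret UL: pair_sigma_finite unit_interval lborel ..
  define E where "E y t = (\<integral>\<^sup>+x. F (y + t *\<^sub>R (x - y)) * indicator S x \<partial>lborel)" for y t
  define C where "C = ennreal (2 ^ DIM('a)) * (\<integral>\<^sup>+x. F x \<partial>lborel) * emeasure lborel S"
  have C: "C < \<infinity>" using fin S1 by (simp add: C_def ennreal_mult_less_top)
  have E: "(\<integral>\<^sup>+y. E y t * indicator S y \<partial>lborel) \<le> C" if "0 < t" "t \<le> 1" for t
    unfolding E_def C_def by (rule cone_average_le) (use that in auto)
  have [measurable]: "(\<lambda>y. E y t) \<in> borel_measurable borel" for t
    unfolding E_def by measurable
  have [measurable]: "E y \<in> borel_measurable borel" for y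
    unfolding E_def[abs_def] by measurable
  define A where "A y = (\<integral>\<^sup>+t. E y t \<partial>unit_interval)" for y
  have A[measurable]: "A \<in> borel_measurable borel"
    unfolding A_def E_def by measurable
  \<comment> \<open>the values \<open>t = 4\<^sup>-\<^sup>i\<close> with summable weights; each term is then bounded by the finite sum\<close>
  define D where "D y = (\<Sum>i. ennreal ((1 / 2) ^ i) * E y ((1 / 4) ^ i))" for y
  have D[measurable]: "D \<in> borel_measurable borel"
    unfolding D_def by measurable
  have "(\<integral>\<^sup>+y. A y * indicator S y \<partial>lborel)
      = (\<integral>\<^sup>+y. (\<integral>\<^sup>+t. E y t * indicator S y \<partial>unit_interval) \<partial>lborel)"
    unfolding A_def by (intro nn_integral_cong nn_integral_multc[symmetric]) measurable
  also have "\<dots> = (\<integral>\<^sup>+t. (\<integral>\<^sup>+y. E y t * indicator S y \<partial>lborel) \<partial>unit_interval)"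
    unfolding E_def by (rule UL.Fubini') measurable
  also have "\<dots> \<le> (\<integral>\<^sup>+t. C \<partial>unit_interval)"
    by (intro nn_integral_mono_AE eventually_mono[OF AE_unit_interval]) (use E in auto)
  also have "\<dots> = C" by (simp add: U.emeasure_space_1[simplified])
  finally have A_fin: "(\<integral>\<^sup>+y. A y * indicator S y \<partial>lborel) \<noteq> \<infinity>" using C by auto
  have "(\<integral>\<^sup>+y. D y * indicator S y \<partial>lborel)
      = (\<integral>\<^sup>+y. (\<Sum>i. ennreal ((1 / 2) ^ i) * (E y ((1 / 4) ^ i) * indicator S y)) \<partial>lborel)"
    unfolding D_def by (simp add: ennreal_suminf_multc[symmetric] mult.assoc)
  also have "\<dots> = (\<Sum>i. ennreal ((1 / 2) ^ i) * (\<integral>\<^sup>+y. E y ((1 / 4) ^ i) * indicator S y \<partial>lborel))"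
    by (subst nn_integral_suminf) (simp_all add: nn_integral_cmult)
  also have "\<dots> \<le> (\<Sum>i. ennreal ((1 / 2) ^ i) * C)"
    by (intro suminf_le mult_left_mono E summableI) (auto simp: power_le_one)
  also have "\<dots> = (\<Sum>i. ennreal ((1 / 2) ^ i)) * C"
    by (rule ennreal_suminf_multc)
  also have "(\<Sum>i. ennreal ((1 / 2) ^ i)) = ennreal (\<Sum>i. (1 / 2) ^ i)"
    by (intro suminf_ennreal2) (auto intro: summable_geometric)
  also have "\<dots> * C < \<infinity>" using C by (simp add: ennreal_mult_less_top)
  finally have D_fin: "(\<integral>\<^sup>+y. D y * indicator S y \<partial>lborel) \<noteq> \<infinity>" by auto
  have "AE y in lborel. A y * indicator S y \<noteq> \<infinity>" "AE y in lborel. D y * indicator S y \<noteq> \<infinity>"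
    by (rule nn_integral_PInf_AE; use A_fin D_fin in simp)+
  then have AE: "AE y in lborel. y \<in> S \<longrightarrow> A y < \<infinity> \<and> D y < \<infinity>"
    by eventually_elim (auto simp: less_top)
  have "\<exists>y. y \<in> S \<and> A y < \<infinity> \<and> D y < \<infinity>"
  proof (rule ccontr)
    assume "\<nexists>y. y \<in> S \<and> A y < \<infinity> \<and> D y < \<infinity>"
    then have "AE y in lborel. y \<notin> S" by (intro eventually_mono[OF AE]) blast
    moreover have "\<not> (AE y in lborel. y \<notin> S)"
      using S0 by (subst AE_iff_measurable[of S]) auto
    ultimately show False by contradiction
  qed
  then obtain y where y: "y \<in> S" "A y < \<infinity>" "D y < \<infinity>" by blast
  have "E y ((1 / 4) ^ i) \<le> ennreal (2 ^ i * enn2real (D y))" for i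
  proof -
    have "ennreal ((1 / 2) ^ i) * E y ((1 / 4) ^ i) \<le> D y"
      using sum_le_suminf[OF summableI, of "{i}" "\<lambda>i. ennreal ((1 / 2) ^ i) * E y ((1 / 4) ^ i)"]
      by (simp add: D_def)
    then have "ennreal (2 ^ i) * (ennreal ((1 / 2) ^ i) * E y ((1 / 4) ^ i)) \<le> ennreal (2 ^ i) * D y"
      by (intro mult_left_mono) simp_all
    moreover have "ennreal (2 ^ i) * (ennreal ((1 / 2) ^ i) * E y ((1 / 4) ^ i)) = E y ((1 / 4) ^ i)"
      by (simp add: mult.assoc[symmetric] ennreal_mult[symmetric] power_mult_distrib[symmetric])
    moreover have "D y = ennreal (enn2real (D y))" using y(3) by simp
    ultimately show ?thesis by (simp add: ennreal_mult)
  qed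
  with y show ?thesis
    unfolding A_def E_def by (intro bexI[of _ y] exI[of _ "enn2real (D y)"]) simp_all
qed

section \<open>The cone operator\<close>

lemma borel_measurable_bounded_bilinear:
  fixes h :: "'a::{second_countable_topology, real_normed_vector} \<Rightarrow>
    'b::{second_countable_topology, real_normed_vector} \<Rightarrow> 'c::real_normed_vector"
  assumes "bounded_bilinear h" "f \<in> borel_measurable M" "g \<in> borel_measurable M"
  shows "(\<lambda>x. h (f x) (g x)) \<in> borel_measurable M"
  by (rule borel_measurable_continuous_Pair[OF assms(2,3)])
    (intro bounded_bilinear.continuous_on[OF assms(1)] continuous_intros)

lemmas borel_measurable_top_pairing [measurable (raw)] =
  borel_measurable_bounded_bilinear[OF bounded_bilinear_top_pairing]

lemmas borel_measurable_interior_product [measurable (raw)] =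
  borel_measurable_bounded_bilinear[OF bounded_bilinear_interior_product]

text \<open>
  The homotopy operator of the Poincare lemma on a domain that is star-shaped about \<open>y\<close>.
\<close>

definition cone_primitive :: "nat \<Rightarrow> 'n::{finite,linorder} space \<Rightarrow> 'n form \<Rightarrow> 'n form" where
  "cone_primitive j y w x =
     (\<integral>t. t ^ j *\<^sub>R interior_product (x - y) (w (y + t *\<^sub>R (x - y))) \<partial>unit_interval)"

lemma cone_primitive_measurable:
  assumes [measurable]: "w \<in> borel_measurable borel"
  shows "cone_primitive j y w \<in> borel_measurable borel"
proof -
  interpret U: prob_space unit_interval by (rule prob_space_unit_interval)
  show ?thesis unfolding cone_primitive_def[abs_def] by measurable
qed

lemma cone_primitive_degree:
  assumes "\<And>x. w x \<in> exterior_power (Suc j)"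
  shows "cone_primitive i y w x \<in> exterior_power j"
proof -
  let ?f = "\<lambda>t. t ^ i *\<^sub>R interior_product (x - y) (w (y + t *\<^sub>R (x - y)))"
  have f: "?f t \<in> exterior_power j" for t
    by (intro subspace_scale subspace_exterior_power interior_product_exterior_power assms)
  have "cone_primitive i y w x $ I = 0" if "card I \<noteq> j" for I
  proof (cases "integrable unit_interval ?f")
    case True
    have "cone_primitive i y w x $ I = (\<integral>t. ?f t $ I \<partial>unit_interval)"
      unfolding cone_primitive_def
      by (rule integral_bounded_linear[OF bounded_linear_vec_nth True, symmetric])
    also have "(\<lambda>t. ?f t $ I) = (\<lambda>t. 0)"
      using f that unfolding exterior_power_def by blast
    finally show ?thesis by simp
  qed (simp add: cone_primitive_def not_integrable_integral_eq)
  then show ?thesis by (simp add: exterior_power_def)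
qed

lemma interior_product_bound:
  "\<exists>K>0. \<forall>v \<alpha>. norm (interior_product v (\<alpha> :: 'n::{finite,linorder} exterior)) \<le> norm v * norm \<alpha> * K"
  using bounded_bilinear.pos_bounded[OF bounded_bilinear_interior_product] .

lemma top_pairing_bound:
  "\<exists>K>0. \<forall>\<alpha> \<beta>. \<bar>top_pairing \<alpha> (\<beta> :: 'n::{finite,linorder} exterior)\<bar> \<le> norm \<alpha> * norm \<beta> * K"
  using bounded_bilinear.pos_bounded[OF bounded_bilinear_top_pairing] unfolding real_norm_def .

lemma unit_ball_borel [measurable]: "(ball 0 1 :: 'a::euclidean_space set) \<in> sets borel"
  by simp

text \<open>
  Jensen's inequality moves \<open>\<Phi>\<close> under the integral over \<open>t\<close>; the remaining double integral is the
  one that the choice of \<open>y\<close> makes finite. The scaling constant is lowered to absorb \<open>|x - y|\<close> and the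
  norm of the contraction.
\<close>

lemma cone_primitive_modular:
  fixes w :: "'n::{finite,linorder} form"
  assumes N: "N_function \<Phi>" and w[measurable]: "w \<in> borel_measurable borel" and \<alpha>: "0 < \<alpha>"
    and y: "y \<in> ball 0 1"
    and fin: "(\<integral>\<^sup>+t. (\<integral>\<^sup>+x. ennreal (\<Phi> (\<alpha> * norm (w (y + t *\<^sub>R (x - y)))))
        * indicator (ball 0 1) x \<partial>lborel) \<partial>unit_interval) < \<infinity>"
  shows "\<exists>c>0. (\<integral>\<^sup>+x. ennreal (\<Phi> (norm (c *\<^sub>R cone_primitive j y w x))) * indicator (ball 0 1) x \<partial>lborel) < \<infinity>"
proof -
  interpret U: prob_space unit_interval by (rule prob_space_unit_interval)
  interpret UL: pair_sigma_finite unit_interval lborel ..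
  have [measurable]: "\<Phi> \<in> borel_measurable borel" by (rule N_function_measurable[OF N])
  obtain K where K: "0 < K"
    "\<And>v \<alpha>. norm (interior_product v (\<alpha> :: 'n exterior)) \<le> norm v * norm \<alpha> * K"
    using interior_product_bound by blast
  let ?B = "ball 0 1 :: 'n space set"
  let ?F = "\<lambda>t x. ennreal (\<Phi> (\<alpha> * norm (w (y + t *\<^sub>R (x - y)))))"
  \<comment> \<open>two points of the ball have distance at most \<open>2\<close>, and \<open>K\<close> bounds the contraction\<close>
  define c where "c = \<alpha> / (2 * K)"
  have c: "c > 0" using K \<alpha> by (simp add: c_def)
  have "ennreal (\<Phi> (norm (c *\<^sub>R cone_primitive j y w x))) \<le> (\<integral>\<^sup>+t. ?F t x \<partial>unit_interval)"
    if x: "x \<in> ?B" for x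
  proof -
    let ?g = "\<lambda>t. t ^ j *\<^sub>R interior_product (x - y) (w (y + t *\<^sub>R (x - y)))"
    have xy: "norm (x - y) \<le> 2" using x y norm_triangle_ineq4[of x y] by simp
    have "c *\<^sub>R cone_primitive j y w x = (\<integral>t. c *\<^sub>R ?g t \<partial>unit_interval)"
      unfolding cone_primitive_def by (rule integral_scaleR_right[symmetric])
    then have "ennreal (\<Phi> (norm (c *\<^sub>R cone_primitive j y w x)))
        \<le> (\<integral>\<^sup>+t. ennreal (\<Phi> (norm (c *\<^sub>R ?g t))) \<partial>unit_interval)"
      using U.N_function_jensen[OF N, of "\<lambda>t. c *\<^sub>R ?g t"] by simp
    also have "\<dots> \<le> (\<integral>\<^sup>+t. ?F t x \<partial>unit_interval)"
    proof (intro nn_integral_mono_AE eventually_mono[OF AE_unit_interval] ennreal_leI N_function_mono[OF N])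
      fix t :: real assume t: "0 < t \<and> t \<le> 1"
      have "norm (c *\<^sub>R ?g t) = c * t ^ j * norm (interior_product (x - y) (w (y + t *\<^sub>R (x - y))))"
        using c t by (simp add: power_abs)
      also have "\<dots> \<le> c * 1 * (2 * norm (w (y + t *\<^sub>R (x - y))) * K)"
        using c t xy K(1)
        by (intro mult_mono power_le_one order_trans[OF K(2)] mult_right_mono) auto
      also have "\<dots> = \<alpha> * norm (w (y + t *\<^sub>R (x - y)))" using K(1) by (simp add: c_def)
      finally show "norm (c *\<^sub>R ?g t) \<le> \<alpha> * norm (w (y + t *\<^sub>R (x - y)))" .
    qed simp
    finally show ?thesis .
  qed
  then have "(\<integral>\<^sup>+x. ennreal (\<Phi> (norm (c *\<^sub>R cone_primitive j y w x))) * indicator ?B x \<partial>lborel)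
      \<le> (\<integral>\<^sup>+x. (\<integral>\<^sup>+t. ?F t x * indicator ?B x \<partial>unit_interval) \<partial>lborel)"
    by (intro nn_integral_mono) (auto simp: nn_integral_multc split: split_indicator)
  also have "\<dots> = (\<integral>\<^sup>+t. (\<integral>\<^sup>+x. ?F t x * indicator ?B x \<partial>lborel) \<partial>unit_interval)"
    by (rule UL.Fubini') measurable
  also note fin
  finally show ?thesis using c by blast
qed

lemma bounded_of_compact_support:
  fixes g :: "'a::topological_space \<Rightarrow> 'b::real_normed_vector"
  assumes "continuous_on UNIV g" "compact K" "K \<subseteq> U" "\<And>x. x \<notin> K \<Longrightarrow> g x = 0"
  obtains C where "0 \<le> C" "\<And>x. norm (g x) \<le> C * indicator U x"
proof -
  have "bounded (g ` K)"
    using assms by (intro compact_imp_bounded compact_continuous_image continuous_on_subset[OF assms(1)]) auto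
  then obtain C where C: "\<And>x. x \<in> K \<Longrightarrow> norm (g x) \<le> C" by (auto simp: bounded_iff)
  have "norm (g x) \<le> max C 0 * indicator U x" for x
    using C[of x] assms(3,4) by (cases "x \<in> K") (auto split: split_indicator)
  then show ?thesis by (rule that[rotated]) simp
qed

lemma continuous_on_frechet_derivative:
  fixes u :: "'n::finite space \<Rightarrow> 'b::real_normed_vector"
  assumes "smooth u" "continuous_on UNIV g"
  shows "continuous_on UNIV (\<lambda>x. frechet_derivative u (at x) (g x))"
proof -
  have "frechet_derivative u (at x) (g x) = (\<Sum>i\<in>UNIV. g x $ i *\<^sub>R frechet_derivative u (at x) (axis i 1))" for x
  proof -
    have lin: "linear (frechet_derivative u (at x))"
      by (rule bounded_linear.linear[OF smooth_linear_derivative[OF assms(1)]])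
    have "g x = (\<Sum>i\<in>UNIV. g x $ i *\<^sub>R axis i 1)"
      using basis_expansion[of "g x"] by (simp add: scalar_mult_eq_scaleR)
    then have "frechet_derivative u (at x) (g x) = frechet_derivative u (at x) (\<Sum>i\<in>UNIV. g x $ i *\<^sub>R axis i 1)"
      by simp
    then show ?thesis by (simp only: linear_sum[OF lin] linear_scale[OF lin])
  qed
  then show ?thesis
    by (simp only:) (intro continuous_intros smooth_continuous[OF smooth_directional_derivative[OF assms(1)]] assms(2))
qed

lemma integrable_top_pairing:
  fixes w :: "'a \<Rightarrow> 'n::{finite,linorder} exterior"
  assumes "integrable M w" "g \<in> borel_measurable M" "\<And>x. norm (g x) \<le> C"
  shows "integrable M (\<lambda>x. top_pairing (w x) (g x))"
proof -
  obtain K where K: "0 < K" "\<And>\<alpha> \<beta>. \<bar>top_pairing \<alpha> (\<beta> :: 'n exterior)\<bar> \<le> norm \<alpha> * norm \<beta> * K"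
    using top_pairing_bound by blast
  show ?thesis
  proof (rule Bochner_Integration.integrable_bound[of _ "\<lambda>x. norm (w x) * (C * K)"])
    show "integrable M (\<lambda>x. norm (w x) * (C * K))" using assms(1) by simp
    show "(\<lambda>x. top_pairing (w x) (g x)) \<in> borel_measurable M"
      using assms(1,2) by (intro borel_measurable_top_pairing) auto
    have "\<bar>top_pairing (w x) (g x)\<bar> \<le> norm (w x) * C * K" for x
      using K(1) assms(3) by (intro order_trans[OF K(2)] mult_right_mono mult_left_mono) auto
    then show "AE x in M. norm (top_pairing (w x) (g x)) \<le> norm (norm (w x) * (C * K))"
      by (intro AE_I2) (auto intro: order_trans[OF _ abs_ge_self] simp: mult.assoc)
  qed
qed

section \<open>Weakly closed forms seen from a base point\<close>

text \<open>
  A closed form together with a vertex \<open>y\<close> as provided by \<open>exists_good_base_point\<close>. Closedness is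
  expressed by vanishing integrals against differentials of test forms, whose degree
  \<open>n - j - 2\<close> is the one that fits.
\<close>

locale closed_form_at_base_point =
  fixes w :: "'n::{finite,linorder} form" and j :: nat and y :: "'n space" and M :: real
  assumes degree: "\<And>x. w x \<in> exterior_power (Suc j)"
    and integrable: "integrable lborel w"
    and base: "y \<in> ball 0 1"
    and cone_finite: "(\<integral>\<^sup>+t. (\<integral>\<^sup>+x. ennreal (norm (w (y + t *\<^sub>R (x - y)))) * indicator (ball 0 1) x \<partial>lborel)
      \<partial>unit_interval) < \<infinity>"
    and shrink: "0 \<le> M" "\<And>i. (\<integral>\<^sup>+x. ennreal (norm (w (y + (1 / 4) ^ i *\<^sub>R (x - y)))) * indicator (ball 0 1) x \<partial>lborel)
      \<le> ennreal (2 ^ i * M)"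
    and closed: "\<And>m v. test_form m (ball 0 1) v \<Longrightarrow> j + 2 + m = CARD('n) \<Longrightarrow>
      (\<integral>x. top_pairing (w x) (ext_deriv v x) \<partial>lborel) = 0"
begin

lemma w_measurable [measurable]: "w \<in> borel_measurable borel"
  using borel_measurable_integrable[OF integrable] by simp

text \<open>
  The integral over \<open>t\<close> that defines the primitive converges at almost every point \<open>x\<close>, by Fubini.
  There the linear pairing passes under the integral sign, and the contraction is moved to the
  other factor.
\<close>

lemma cone_primitive_pairing:
  "AE x in lborel. x \<in> ball 0 1 \<longrightarrow> (\<forall>\<beta>. top_pairing (cone_primitive j y w x) \<beta> =
     (-1) ^ j * (\<integral>t. t ^ j * top_pairing (w (y + t *\<^sub>R (x - y))) (interior_product (x - y) \<beta>) \<partial>unit_interval))"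
proof -
  interpret U: prob_space unit_interval by (rule prob_space_unit_interval)
  interpret UL: pair_sigma_finite unit_interval lborel ..
  interpret P: bounded_bilinear "top_pairing :: 'n exterior \<Rightarrow> _" by (rule bounded_bilinear_top_pairing)
  obtain K where K: "0 < K"
    "\<And>v \<alpha>. norm (interior_product v (\<alpha> :: 'n exterior)) \<le> norm v * norm \<alpha> * K"
    using interior_product_bound by blast
  have "(\<integral>\<^sup>+x. (\<integral>\<^sup>+t. ennreal (norm (w (y + t *\<^sub>R (x - y)))) * indicator (ball 0 1) x \<partial>unit_interval) \<partial>lborel)
     = (\<integral>\<^sup>+t. (\<integral>\<^sup>+x. ennreal (norm (w (y + t *\<^sub>R (x - y)))) * indicator (ball 0 1) x \<partial>lborel) \<partial>unit_interval)"
    by (rule UL.Fubini') measurable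
  then have "AE x in lborel. (\<integral>\<^sup>+t. ennreal (norm (w (y + t *\<^sub>R (x - y)))) * indicator (ball 0 1) x \<partial>unit_interval) \<noteq> \<infinity>"
    using cone_finite by (intro nn_integral_PInf_AE) auto
  then show ?thesis
  proof eventually_elim
    case (elim x)
    show ?case
    proof (intro impI allI)
      fix \<beta> assume "x \<in> ball 0 1"
      with elim have fin: "(\<integral>\<^sup>+t. ennreal (norm (w (y + t *\<^sub>R (x - y)))) \<partial>unit_interval) < \<infinity>"
        by (simp add: less_top)
      let ?g = "\<lambda>t. t ^ j *\<^sub>R interior_product (x - y) (w (y + t *\<^sub>R (x - y)))"
      have int: "integrable unit_interval ?g"
      proof (rule Bochner_Integration.integrable_bound)
        show "integrable unit_interval (\<lambda>t. norm (x - y) * norm (w (y + t *\<^sub>R (x - y))) * K)"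
          using fin by (intro integrable_mult_left integrable_mult_right integrableI_nonneg) auto
        show "AE t in unit_interval. norm (?g t) \<le> norm (norm (x - y) * norm (w (y + t *\<^sub>R (x - y))) * K)"
        proof (rule eventually_mono[OF AE_unit_interval])
          fix t :: real assume t: "0 < t \<and> t \<le> 1"
          have "norm (?g t) = t ^ j * norm (interior_product (x - y) (w (y + t *\<^sub>R (x - y))))"
            using t by (simp add: power_abs)
          also have "\<dots> \<le> 1 * (norm (x - y) * norm (w (y + t *\<^sub>R (x - y))) * K)"
            using t K(1) by (intro mult_mono power_le_one K(2)) auto
          finally show "norm (?g t) \<le> norm (norm (x - y) * norm (w (y + t *\<^sub>R (x - y))) * K)"
            using K(1) by simp
        qed
      qed measurable
      have "top_pairing (cone_primitive j y w x) \<beta> = (\<integral>t. top_pairing (?g t) \<beta> \<partial>unit_interval)"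
        unfolding cone_primitive_def
        by (rule integral_bounded_linear[OF P.bounded_linear_left int, symmetric])
      also have "\<dots> = (\<integral>t. (-1) ^ j * (t ^ j * top_pairing (w (y + t *\<^sub>R (x - y))) (interior_product (x - y) \<beta>)) \<partial>unit_interval)"
        by (simp add: P.scaleR_left top_pairing_interior_product[OF degree] mult_ac)
      finally show "top_pairing (cone_primitive j y w x) \<beta> =
        (-1) ^ j * (\<integral>t. t ^ j * top_pairing (w (y + t *\<^sub>R (x - y))) (interior_product (x - y) \<beta>) \<partial>unit_interval)"
        by simp
    qed
  qed
qed

text \<open>
  The integrand that remains for each \<open>t\<close> after the integral over \<open>x\<close> has been pulled inside.
\<close>

definition slice :: "'n form \<Rightarrow> real \<Rightarrow> real" where
  "slice g t = (\<integral>x. t ^ j * top_pairing (w (y + t *\<^sub>R (x - y))) (g x) \<partial>lborel)"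

lemma cone_pairing_integrable:
  assumes g: "continuous_on UNIV g" "\<And>x. norm (g x) \<le> C * indicator (ball 0 1) x" "0 \<le> C"
  shows "integrable (unit_interval \<Otimes>\<^sub>M lborel)
    (\<lambda>(t, x). t ^ j * top_pairing (w (y + t *\<^sub>R (x - y))) (g x))"
proof (rule integrableI_bounded)
  interpret U: prob_space unit_interval by (rule prob_space_unit_interval)
  interpret UL: pair_sigma_finite unit_interval lborel ..
  have [measurable]: "g \<in> borel_measurable borel" by (rule borel_measurable_continuous_onI[OF g(1)])
  let ?f = "\<lambda>(t, x). t ^ j * top_pairing (w (y + t *\<^sub>R (x - y))) (g x)"
  show m: "?f \<in> borel_measurable (unit_interval \<Otimes>\<^sub>M lborel)" by measurable
  obtain K where K: "0 < K" "\<And>\<alpha> \<beta>. \<bar>top_pairing \<alpha> (\<beta> :: 'n exterior)\<bar> \<le> norm \<alpha> * norm \<beta> * K"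
    using top_pairing_bound by blast
  have "(\<integral>\<^sup>+p. ennreal (norm (?f p)) \<partial>(unit_interval \<Otimes>\<^sub>M lborel))
      = (\<integral>\<^sup>+t. (\<integral>\<^sup>+x. ennreal (norm (?f (t, x))) \<partial>lborel) \<partial>unit_interval)"
    by (rule lborel.nn_integral_fst[symmetric]) measurable
  also have "\<dots> \<le> (\<integral>\<^sup>+t. (\<integral>\<^sup>+x. ennreal (C * K) * (ennreal (norm (w (y + t *\<^sub>R (x - y)))) * indicator (ball 0 1) x) \<partial>lborel) \<partial>unit_interval)"
  proof (intro nn_integral_mono_AE[OF eventually_mono[OF AE_unit_interval]] nn_integral_mono)
    fix t :: real and x :: "'n space" assume t: "0 < t \<and> t \<le> 1"
    have "norm (?f (t, x)) = t ^ j * \<bar>top_pairing (w (y + t *\<^sub>R (x - y))) (g x)\<bar>"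
      using t by (simp add: abs_mult power_abs)
    also have "\<dots> \<le> 1 * (norm (w (y + t *\<^sub>R (x - y))) * (C * indicator (ball 0 1) x) * K)"
      using t K(1) g(2,3)
      by (intro mult_mono[OF power_le_one] order_trans[OF K(2)] mult_right_mono mult_left_mono) auto
    finally have "norm (?f (t, x)) \<le> (C * K) * (norm (w (y + t *\<^sub>R (x - y))) * indicator (ball 0 1) x)"
      by (simp add: mult_ac)
    then show "ennreal (norm (?f (t, x))) \<le> ennreal (C * K) * (ennreal (norm (w (y + t *\<^sub>R (x - y)))) * indicator (ball 0 1) x)"
      using K(1) g(3) by (subst ennreal_indicator[symmetric]) (simp add: ennreal_mult[symmetric] ennreal_leI)
  qed
  also have "\<dots> = ennreal (C * K) * (\<integral>\<^sup>+t. (\<integral>\<^sup>+x. ennreal (norm (w (y + t *\<^sub>R (x - y)))) * indicator (ball 0 1) x \<partial>lborel) \<partial>unit_interval)"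
    by (simp add: nn_integral_cmult)
  also have "\<dots> < \<infinity>" using cone_finite by (simp add: ennreal_mult_less_top)
  finally show "(\<integral>\<^sup>+p. ennreal (norm (?f p)) \<partial>(unit_interval \<Otimes>\<^sub>M lborel)) < \<infinity>" .
qed

lemma integral_cone_primitive:
  assumes u: "test_form m (ball 0 1) u"
  defines "g \<equiv> \<lambda>x. interior_product (x - y) (ext_deriv u x)"
  shows "(\<integral>x. top_pairing (cone_primitive j y w x) (ext_deriv u x) \<partial>lborel)
      = (-1) ^ j * (\<integral>t. slice g t \<partial>unit_interval)"
    and "integrable unit_interval (slice g)"
proof -
  interpret U: prob_space unit_interval by (rule prob_space_unit_interval)
  interpret UL: pair_sigma_finite unit_interval lborel ..
  have cont: "continuous_on UNIV (ext_deriv u)"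
    by (rule smooth_continuous[OF smooth_ext_deriv[OF test_form_smooth[OF u]]])
  then have cg: "continuous_on UNIV g"
    unfolding g_def by (intro bounded_bilinear.continuous_on[OF bounded_bilinear_interior_product] continuous_intros)
  have [measurable]: "ext_deriv u \<in> borel_measurable borel" "g \<in> borel_measurable borel"
    using cont cg by (auto intro: borel_measurable_continuous_onI)
  note [measurable] = cone_primitive_measurable[OF w_measurable]
  obtain K where K: "compact K" "K \<subseteq> ball 0 1" "\<And>x. x \<notin> K \<Longrightarrow> ext_deriv u x = 0"
    using test_form_compact_support[OF u] by metis
  have "g x = 0" if "x \<notin> K" for x
    by (simp add: g_def K(3)[OF that] bounded_bilinear.zero_right[OF bounded_bilinear_interior_product])
  then obtain C where C: "0 \<le> C" "\<And>x. norm (g x) \<le> C * indicator (ball 0 1) x"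
    using bounded_of_compact_support[OF cg K(1,2)] by metis
  note int = cone_pairing_integrable[OF cg C(2,1)]
  have "(\<integral>x. top_pairing (cone_primitive j y w x) (ext_deriv u x) \<partial>lborel) =
    (\<integral>x. (-1) ^ j * (\<integral>t. t ^ j * top_pairing (w (y + t *\<^sub>R (x - y))) (g x) \<partial>unit_interval) \<partial>lborel)"
  proof (rule integral_cong_AE)
    show "AE x in lborel. top_pairing (cone_primitive j y w x) (ext_deriv u x) =
        (-1) ^ j * (\<integral>t. t ^ j * top_pairing (w (y + t *\<^sub>R (x - y))) (g x) \<partial>unit_interval)"
      using cone_primitive_pairing
    proof eventually_elim
      case (elim x)
      show ?case
      proof (cases "x \<in> ball 0 1")
        case True
        with elim show ?thesis by (simp add: g_def)
      next
        case False
        then have "x \<notin> K" using K(2) by blast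
        then show ?thesis
          by (simp add: g_def K(3) bounded_bilinear.zero_right[OF bounded_bilinear_interior_product]
            bounded_bilinear.zero_right[OF bounded_bilinear_top_pairing])
      qed
    qed
  qed measurable
  also have "\<dots> = (-1) ^ j * (\<integral>x. (\<integral>t. t ^ j * top_pairing (w (y + t *\<^sub>R (x - y))) (g x) \<partial>unit_interval) \<partial>lborel)"
    by simp
  also have "(\<integral>x. (\<integral>t. t ^ j * top_pairing (w (y + t *\<^sub>R (x - y))) (g x) \<partial>unit_interval) \<partial>lborel)
     = (\<integral>t. slice g t \<partial>unit_interval)"
    unfolding slice_def by (rule UL.Fubini_integral[OF int])
  finally show "(\<integral>x. top_pairing (cone_primitive j y w x) (ext_deriv u x) \<partial>lborel)
      = (-1) ^ j * (\<integral>t. slice g t \<partial>unit_interval)" .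
  show "integrable unit_interval (slice g)"
    unfolding slice_def[abs_def] using UL.integrable_fst[OF int] .
qed

text \<open>
  Composition with the inverse of the dilation \<open>x \<mapsto> y + t (x - y)\<close>. For a form of degree \<open>m\<close> the
  pullback carries an additional factor \<open>(1 / t) ^ m\<close>.
\<close>

definition shrunk :: "'n form \<Rightarrow> real \<Rightarrow> 'n form" where
  "shrunk g t z = g ((y - (1 / t) *\<^sub>R y) + (1 / t) *\<^sub>R z)"

lemma shrunk_measurable [measurable]:
  assumes [measurable]: "g \<in> borel_measurable borel"
  shows "shrunk g t \<in> borel_measurable borel"
  unfolding shrunk_def[abs_def] by measurable

lemma integral_shrunk:
  assumes [measurable]: "g \<in> borel_measurable borel" and t: "0 < t"
  shows "(\<integral>z. top_pairing (w z) (shrunk g t z) \<partial>lborel)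
    = t ^ CARD('n) * (\<integral>x. top_pairing (w (y + t *\<^sub>R (x - y))) (g x) \<partial>lborel)"
proof -
  have 1: "(y - t *\<^sub>R y) + t *\<^sub>R x = y + t *\<^sub>R (x - y)" for x by (simp add: algebra_simps)
  have 2: "shrunk g t ((y - t *\<^sub>R y) + t *\<^sub>R x) = g x" for x
    using t by (simp add: shrunk_def algebra_simps)
  have "(\<integral>z. top_pairing (w z) (shrunk g t z) \<partial>lborel) = t ^ DIM('n space) *
      (\<integral>x. top_pairing (w ((y - t *\<^sub>R y) + t *\<^sub>R x)) (shrunk g t ((y - t *\<^sub>R y) + t *\<^sub>R x)) \<partial>lborel)"
    by (rule integral_lborel_affine) (use t in measurable)
  then show ?thesis unfolding 2 by (simp add: 1)
qed

lemma slice_eq_integral_shrunk: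
  assumes "g \<in> borel_measurable borel" "0 < t" "CARD('n) = Suc j + m"
  shows "slice g t = (1 / t) ^ Suc m * (\<integral>z. top_pairing (w z) (shrunk g t z) \<partial>lborel)"
proof -
  have "(1 / t) ^ Suc m * t ^ CARD('n) = (1 / t) ^ Suc m * t ^ Suc m * t ^ j"
    by (simp add: assms(3) power_add)
  also have "\<dots> = t ^ j" using assms(2) by (simp add: power_mult_distrib[symmetric])
  finally show ?thesis
    using integral_shrunk[OF assms(1,2)] by (simp add: slice_def mult.assoc[symmetric])
qed

text \<open>
  The Lie derivative of a form of degree \<open>m\<close> along the radial field \<open>x - y\<close>.
\<close>

definition euler :: "nat \<Rightarrow> 'n form \<Rightarrow> 'n form" where
  "euler m u x = real m *\<^sub>R u x + frechet_derivative u (at x) (x - y)"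

text \<open>
  Dilation commutes with \<open>d\<close> up to a factor, and the dilated form \<open>\<iota>\<^sub>x\<^sub>-\<^sub>y u\<close> is again a test form on the
  ball, so weak closedness applies to it. For \<open>m = 0\<close> the contraction is zero.
\<close>

lemma closed_interior_product:
  assumes u: "test_form m (ball 0 1) u" and n: "CARD('n) = Suc j + m" and t: "0 < t" "t \<le> 1"
  shows "(\<integral>z. top_pairing (w z) (shrunk (ext_deriv (\<lambda>x. interior_product (x - y) (u x))) t z) \<partial>lborel) = 0"
proof (cases m)
  case 0
  have "interior_product (x - y) (u x) = 0" for x
    using contract_exterior_power_0[of "u x"] test_form_degree[OF u[unfolded 0], of x]
    by (simp add: interior_product_def)
  then have "ext_deriv (\<lambda>x. interior_product (x - y) (u x)) = (\<lambda>x. 0)"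
    by (auto simp: ext_deriv_def frechet_derivative_const linear_0[OF bounded_linear.linear[OF bounded_linear_wedge]])
  then show ?thesis
    by (simp add: shrunk_def bounded_bilinear.zero_right[OF bounded_bilinear_top_pairing])
next
  case (Suc l)
  define v where "v = (\<lambda>x. interior_product (x - y) (u x))"
  have v: "test_form l (ball 0 1) v"
    unfolding v_def by (rule test_form_interior_product[OF u[unfolded Suc]])
  have sv: "test_form l (ball 0 1) (shrunk v t)"
    unfolding shrunk_def[abs_def] by (rule test_form_dilate[OF v convex_ball base t])
  have "shrunk (ext_deriv v) t z = t *\<^sub>R ext_deriv (shrunk v t) z" for z
    using ext_deriv_compose_affine[OF test_form_smooth[OF v], of "y - (1 / t) *\<^sub>R y" "1 / t" z] t
    by (simp add: shrunk_def[abs_def])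
  then have "(\<integral>z. top_pairing (w z) (shrunk (ext_deriv v) t z) \<partial>lborel)
      = t * (\<integral>z. top_pairing (w z) (ext_deriv (shrunk v t) z) \<partial>lborel)"
    by (simp add: bounded_bilinear.scaleR_right[OF bounded_bilinear_top_pairing])
  also have "\<dots> = 0" using closed[OF sv] n Suc by simp
  finally show ?thesis by (simp add: v_def)
qed

lemma test_form_bounds:
  assumes u: "test_form m (ball 0 1) u"
  shows "continuous_on UNIV u" "continuous_on UNIV (euler m u)"
    "continuous_on UNIV (ext_deriv (\<lambda>x. interior_product (x - y) (u x)))"
    "\<exists>C\<ge>0. \<forall>x. norm (u x) \<le> C * indicator (ball 0 1) x \<and>
      norm (euler m u x) \<le> C * indicator (ball 0 1) x \<and>
      norm (ext_deriv (\<lambda>x. interior_product (x - y) (u x)) x) \<le> C * indicator (ball 0 1) x"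
proof -
  note sm = test_form_smooth[OF u]
  let ?v = "\<lambda>x. interior_product (x - y) (u x)"
  have sv: "smooth ?v"
    by (rule smooth_bounded_bilinear[OF bounded_bilinear_interior_product smooth_affine sm])
  show c: "continuous_on UNIV u" by (rule smooth_continuous[OF sm])
  show ce: "continuous_on UNIV (euler m u)"
    unfolding euler_def[abs_def]
    by (intro continuous_intros c continuous_on_frechet_derivative[OF sm])
  show cv: "continuous_on UNIV (ext_deriv ?v)"
    by (rule smooth_continuous[OF smooth_ext_deriv[OF sv]])
  obtain K where K: "compact K" "K \<subseteq> ball 0 1" "\<And>x. x \<notin> K \<Longrightarrow> u x = 0"
      "\<And>x v. x \<notin> K \<Longrightarrow> frechet_derivative u (at x) v = 0" "\<And>x. x \<notin> K \<Longrightarrow> ext_deriv u x = 0"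
    using test_form_compact_support[OF u] by metis
  have e0: "euler m u x = 0" if "x \<notin> K" for x by (simp add: euler_def K(3,4)[OF that])
  have v0: "ext_deriv ?v x = 0" if "x \<notin> K" for x
    using interior_product_ext_deriv[OF sm test_form_degree[OF u], of x y]
    by (simp add: K(3-5)[OF that] bounded_bilinear.zero_right[OF bounded_bilinear_interior_product])
  obtain C1 where C1: "0 \<le> C1" "\<And>x. norm (u x) \<le> C1 * indicator (ball 0 1) x"
    using bounded_of_compact_support[OF c K(1,2,3)] by metis
  obtain C2 where C2: "0 \<le> C2" "\<And>x. norm (euler m u x) \<le> C2 * indicator (ball 0 1) x"
    using bounded_of_compact_support[OF ce K(1,2) e0] by metis
  obtain C3 where C3: "0 \<le> C3" "\<And>x. norm (ext_deriv ?v x) \<le> C3 * indicator (ball 0 1) x"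
    using bounded_of_compact_support[OF cv K(1,2) v0] by metis
  \<comment> \<open>a common bound for the three forms\<close>
  let ?C = "C1 + C2 + C3"
  have le: "r \<le> ?C * indicator (ball 0 1) x" if "r \<le> c * indicator (ball 0 1) x" "c \<le> ?C" for r c and x :: "'n space"
    using that by (auto split: split_indicator_asm)
  show "\<exists>C\<ge>0. \<forall>x. norm (u x) \<le> C * indicator (ball 0 1) x \<and>
      norm (euler m u x) \<le> C * indicator (ball 0 1) x \<and>
      norm (ext_deriv ?v x) \<le> C * indicator (ball 0 1) x"
    using C1(1) C2(1) C3(1)
    by (intro exI[of _ ?C] conjI allI le[OF C1(2)] le[OF C2(2)] le[OF C3(2)]) auto
qed

text \<open>
  Cartan's formula and the vanishing of its exact part.
\<close>

lemma slice_euler: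
  assumes u: "test_form m (ball 0 1) u" and n: "CARD('n) = Suc j + m" and t: "0 < t" "t \<le> 1"
  shows "slice (\<lambda>x. interior_product (x - y) (ext_deriv u x)) t
    = (1 / t) ^ Suc m * (\<integral>z. top_pairing (w z) (shrunk (euler m u) t z) \<partial>lborel)"
proof -
  let ?v = "\<lambda>x. interior_product (x - y) (u x)"
  note c = test_form_bounds(1-3)[OF u]
  have [measurable]: "euler m u \<in> borel_measurable borel" "ext_deriv ?v \<in> borel_measurable borel"
    using c by (auto intro: borel_measurable_continuous_onI)
  obtain C where C: "0 \<le> C" "\<forall>x. norm (u x) \<le> C * indicator (ball 0 1) x \<and>
      norm (euler m u x) \<le> C * indicator (ball 0 1) x \<and>
      norm (ext_deriv ?v x) \<le> C * indicator (ball 0 1) x"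
    using test_form_bounds(4)[OF u] by blast
  have C': "norm (euler m u x) \<le> C" "norm (ext_deriv ?v x) \<le> C" for x
    using C(1) C(2)[rule_format, of x] by (auto split: split_indicator_asm)
  have g: "(\<lambda>x. interior_product (x - y) (ext_deriv u x)) = (\<lambda>x. euler m u x - ext_deriv ?v x)"
    using interior_product_ext_deriv[OF test_form_smooth[OF u] test_form_degree[OF u]]
    by (simp add: euler_def fun_eq_iff)
  have i1: "integrable lborel (\<lambda>z. top_pairing (w z) (shrunk (euler m u) t z))"
    by (rule integrable_top_pairing[OF integrable, where C = C]) (simp_all add: shrunk_def C')
  have i2: "integrable lborel (\<lambda>z. top_pairing (w z) (shrunk (ext_deriv ?v) t z))"
    by (rule integrable_top_pairing[OF integrable, where C = C]) (simp_all add: shrunk_def C')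
  have "slice (\<lambda>x. interior_product (x - y) (ext_deriv u x)) t =
     (1 / t) ^ Suc m * (\<integral>z. top_pairing (w z) (shrunk (\<lambda>x. euler m u x - ext_deriv ?v x) t z) \<partial>lborel)"
    unfolding g by (rule slice_eq_integral_shrunk[OF _ t(1) n]) measurable
  also have "(\<lambda>z. top_pairing (w z) (shrunk (\<lambda>x. euler m u x - ext_deriv ?v x) t z))
      = (\<lambda>z. top_pairing (w z) (shrunk (euler m u) t z) - top_pairing (w z) (shrunk (ext_deriv ?v) t z))"
    by (simp add: shrunk_def bounded_bilinear.diff_right[OF bounded_bilinear_top_pairing])
  also have "(\<integral>z. \<dots> z \<partial>lborel) = (\<integral>z. top_pairing (w z) (shrunk (euler m u) t z) \<partial>lborel)"
    using closed_interior_product[OF u n t] by (simp add: Bochner_Integration.integral_diff[OF i1 i2])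
  finally show ?thesis .
qed

text \<open>
  The flow of the radial field consists of the dilations, so the derivative in \<open>t\<close> of the pullback
  by the inverse dilation is \<open>- 1 / t\<close> times the pullback of the Lie derivative.
\<close>

lemma has_derivative_shrunk:
  assumes u: "smooth u" and t: "0 < t"
  shows "((\<lambda>t. top_pairing \<alpha> ((1 / t) ^ m *\<^sub>R shrunk u t z)) has_real_derivative
     - ((1 / t) ^ Suc m * top_pairing \<alpha> (shrunk (euler m u) t z))) (at t)"
proof -
  let ?\<psi> = "\<lambda>t. (y - (1 / t) *\<^sub>R y) + (1 / t) *\<^sub>R z"
  interpret D: bounded_linear "frechet_derivative u (at (?\<psi> t))" by (rule smooth_linear_derivative[OF u])
  have r: "((\<lambda>t. 1 / t) has_derivative (\<lambda>h. - h / t\<^sup>2)) (at t)"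
  proof -
    have "((\<lambda>t. 1 / t) has_real_derivative - 1 / t\<^sup>2) (at t)"
      using t by (auto intro!: derivative_eq_intros simp: power2_eq_square)
    moreover have "(*) (- 1 / t\<^sup>2) = (\<lambda>h. - h / t\<^sup>2)" by auto
    ultimately show ?thesis unfolding has_field_derivative_def by simp
  qed
  have "?\<psi> = (\<lambda>t. y + (1 / t) *\<^sub>R (z - y))" by (simp add: fun_eq_iff scaleR_diff_right)
  then have \<psi>: "(?\<psi> has_derivative (\<lambda>h. (- h / t\<^sup>2) *\<^sub>R (z - y))) (at t)"
    using has_derivative_add[OF has_derivative_const has_derivative_scaleR_left[OF r], of y "z - y"]
    by simp
  \<comment> \<open>rewrites the velocity of the dilation as the radial field at the dilated point\<close>
  have zy: "z - y = t *\<^sub>R (?\<psi> t - y)" using t by (simp add: algebra_simps)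
  have 1: "((\<lambda>t. shrunk u t z) has_derivative
      (\<lambda>h. (- h / t) *\<^sub>R frechet_derivative u (at (?\<psi> t)) (?\<psi> t - y))) (at t)"
  proof -
    have "((\<lambda>t. u (?\<psi> t)) has_derivative (\<lambda>h. frechet_derivative u (at (?\<psi> t)) ((- h / t\<^sup>2) *\<^sub>R (z - y)))) (at t)"
      by (rule has_derivative_compose[OF \<psi> smooth_has_derivative[OF u]])
    moreover have "frechet_derivative u (at (?\<psi> t)) ((- h / t\<^sup>2) *\<^sub>R (z - y))
        = (- h / t) *\<^sub>R frechet_derivative u (at (?\<psi> t)) (?\<psi> t - y)" for h
      unfolding zy scaleR_scaleR D.scaleR using t by (simp add: power2_eq_square)
    ultimately show ?thesis by (simp add: shrunk_def)
  qed
  have 2: "((\<lambda>t. (1 / t) ^ m) has_derivative (\<lambda>h. - (h * real m * (1 / t) ^ Suc m))) (at t)"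
  proof -
    have "(\<lambda>h. real m * (- h / t\<^sup>2) * (1 / t) ^ (m - 1)) = (\<lambda>h. - (h * real m * (1 / t) ^ Suc m))"
      by (cases m) (auto simp: power2_eq_square)
    then show ?thesis using has_derivative_power[OF r, of m] by simp
  qed
  have "((\<lambda>t. (1 / t) ^ m *\<^sub>R shrunk u t z) has_derivative
      (\<lambda>h. (1 / t) ^ m *\<^sub>R ((- h / t) *\<^sub>R frechet_derivative u (at (?\<psi> t)) (?\<psi> t - y))
        + (- (h * real m * (1 / t) ^ Suc m)) *\<^sub>R shrunk u t z)) (at t)"
    by (rule has_derivative_scaleR[OF 2 1])
  also have "(\<lambda>h. (1 / t) ^ m *\<^sub>R ((- h / t) *\<^sub>R frechet_derivative u (at (?\<psi> t)) (?\<psi> t - y))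
        + (- (h * real m * (1 / t) ^ Suc m)) *\<^sub>R shrunk u t z)
      = (\<lambda>h. (- (h * (1 / t) ^ Suc m)) *\<^sub>R shrunk (euler m u) t z)"
    by (simp add: shrunk_def euler_def fun_eq_iff scaleR_add_right mult_ac)
  finally have 3: "((\<lambda>t. (1 / t) ^ m *\<^sub>R shrunk u t z) has_derivative
      (\<lambda>h. (- (h * (1 / t) ^ Suc m)) *\<^sub>R shrunk (euler m u) t z)) (at t)" .
  show ?thesis
    unfolding has_field_derivative_def
    by (rule has_derivative_eq_rhs[OF bounded_linear.has_derivative[OF
          bounded_bilinear.bounded_linear_right[OF bounded_bilinear_top_pairing] 3]])
      (simp add: fun_eq_iff bounded_bilinear.scaleR_right[OF bounded_bilinear_top_pairing]
        bounded_bilinear.minus_right[OF bounded_bilinear_top_pairing])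
qed

text \<open>
  Away from \<open>t = 0\<close> the integrand is bounded by a multiple of \<open>|w|\<close>, so the integral over \<open>t\<close> may be
  taken first. For each \<open>z\<close> it is evaluated by the fundamental theorem of calculus.
\<close>

lemma integral_slice_from:
  assumes u: "test_form m (ball 0 1) u" and n: "CARD('n) = Suc j + m" and \<epsilon>: "0 < \<epsilon>" "\<epsilon> \<le> 1"
  shows "(\<integral>t. indicator {\<epsilon>..1} t * slice (\<lambda>x. interior_product (x - y) (ext_deriv u x)) t \<partial>lborel)
    = (1 / \<epsilon>) ^ m * (\<integral>z. top_pairing (w z) (shrunk u \<epsilon> z) \<partial>lborel)
      - (\<integral>z. top_pairing (w z) (u z) \<partial>lborel)"
proof -
  note c = test_form_bounds(1-2)[OF u]
  have [measurable]: "u \<in> borel_measurable borel" "euler m u \<in> borel_measurable borel"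
    using c by (auto intro: borel_measurable_continuous_onI)
  obtain C where C: "0 \<le> C" "\<forall>x. norm (u x) \<le> C * indicator (ball 0 1) x \<and>
      norm (euler m u x) \<le> C * indicator (ball 0 1) x \<and>
      norm (ext_deriv (\<lambda>x. interior_product (x - y) (u x)) x) \<le> C * indicator (ball 0 1) x"
    using test_form_bounds(4)[OF u] by blast
  have C': "norm (u x) \<le> C" "norm (euler m u x) \<le> C" for x
    using C(1) C(2)[rule_format, of x] by (auto split: split_indicator_asm)
  obtain K where K: "0 < K" "\<And>\<alpha> \<beta>. \<bar>top_pairing \<alpha> (\<beta> :: 'n exterior)\<bar> \<le> norm \<alpha> * norm \<beta> * K"
    using top_pairing_bound by blast
  define Q where "Q t z = (1 / t) ^ Suc m * top_pairing (w z) (shrunk (euler m u) t z)" for t z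
  have Q_meas [measurable]: "(\<lambda>(t, z). Q t z) \<in> borel_measurable (borel \<Otimes>\<^sub>M borel)"
    unfolding Q_def shrunk_def by measurable
  have Q_int: "integrable (lborel \<Otimes>\<^sub>M lborel) (\<lambda>(t, z). indicator {\<epsilon>..1} t * Q t z)"
  proof (rule integrableI_bounded)
    let ?f = "\<lambda>(t, z). indicator {\<epsilon>..1} t * Q t z"
    let ?D = "(1 / \<epsilon>) ^ Suc m * (C * K)"
    have D: "0 \<le> ?D" using \<epsilon> C(1) K(1) by simp
    show "?f \<in> borel_measurable (lborel \<Otimes>\<^sub>M lborel)" by measurable
    have "(\<integral>\<^sup>+p. ennreal (norm (?f p)) \<partial>(lborel \<Otimes>\<^sub>M lborel))
        = (\<integral>\<^sup>+t. (\<integral>\<^sup>+z. ennreal (norm (?f (t, z))) \<partial>lborel) \<partial>lborel)"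
      by (rule lborel.nn_integral_fst[symmetric]) measurable
    also have "\<dots> \<le> (\<integral>\<^sup>+t. (\<integral>\<^sup>+z. (ennreal ?D * ennreal (norm (w z))) * indicator {\<epsilon>..1} t \<partial>lborel) \<partial>lborel)"
    proof (intro nn_integral_mono)
      fix t :: real and z :: "'n space"
      show "ennreal (norm (?f (t, z))) \<le> (ennreal ?D * ennreal (norm (w z))) * indicator {\<epsilon>..1} t"
      proof (cases "t \<in> {\<epsilon>..1}")
        case True
        then have t: "0 < t" "\<epsilon> \<le> t" "t \<le> 1" using \<epsilon> by auto
        have "norm (?f (t, z)) = (1 / t) ^ Suc m * \<bar>top_pairing (w z) (shrunk (euler m u) t z)\<bar>"
          using True t by (simp add: Q_def abs_mult power_abs)
        also have "\<dots> \<le> (1 / \<epsilon>) ^ Suc m * (norm (w z) * C * K)"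
        proof (rule mult_mono)
          show "(1 / t) ^ Suc m \<le> (1 / \<epsilon>) ^ Suc m"
            using t \<epsilon> by (intro power_mono) (auto simp: frac_le)
          show "\<bar>top_pairing (w z) (shrunk (euler m u) t z)\<bar> \<le> norm (w z) * C * K"
            using K(1) C'(2) by (intro order_trans[OF K(2)] mult_right_mono mult_left_mono) (auto simp: shrunk_def)
        qed (use \<epsilon> in auto)
        finally have "norm (?f (t, z)) \<le> ?D * norm (w z)" by (simp add: mult_ac)
        then have "ennreal (norm (?f (t, z))) \<le> ennreal ?D * ennreal (norm (w z))"
          using D by (simp add: ennreal_mult[symmetric] ennreal_leI)
        with True show ?thesis by simp
      qed simp
    qed
    also have "\<dots> = ennreal ?D * (\<integral>\<^sup>+z. ennreal (norm (w z)) \<partial>lborel) * emeasure lborel {\<epsilon>..1}"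
      by (simp add: nn_integral_multc nn_integral_cmult nn_integral_cmult_indicator)
    also have "\<dots> < \<infinity>"
      using integrable \<epsilon> by (auto simp: ennreal_mult_less_top integrable_iff_bounded)
    finally show "(\<integral>\<^sup>+p. ennreal (norm (?f p)) \<partial>(lborel \<Otimes>\<^sub>M lborel)) < \<infinity>" .
  qed
  have inner: "(\<integral>t. indicator {\<epsilon>..1} t * Q t z \<partial>lborel)
      = (1 / \<epsilon>) ^ m * top_pairing (w z) (shrunk u \<epsilon> z) - top_pairing (w z) (u z)" for z
  proof -
    \<comment> \<open>an antiderivative of \<open>t \<mapsto> Q t z\<close>\<close>
    let ?F = "\<lambda>t. - top_pairing (w z) ((1 / t) ^ m *\<^sub>R shrunk u t z)"
    have "(\<integral>t. Q t z * indicator {\<epsilon>..1} t \<partial>lborel) = ?F 1 - ?F \<epsilon>"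
    proof (rule integral_FTC_Icc_real[OF \<epsilon>(2)])
      fix t :: real assume "\<epsilon> \<le> t" "t \<le> 1"
      then have t: "0 < t" using \<epsilon> by simp
      show "(?F has_real_derivative Q t z) (at t)"
        using DERIV_minus[OF has_derivative_shrunk[OF test_form_smooth[OF u] t, of "w z" m z]]
        by (simp add: Q_def)
      have "isCont (\<lambda>t. euler m u ((y - (1 / t) *\<^sub>R y) + (1 / t) *\<^sub>R z)) t"
      proof (rule isCont_o2[where g = "euler m u"])
        show "isCont (\<lambda>t. (y - (1 / t) *\<^sub>R y) + (1 / t) *\<^sub>R z) t"
          using t by (intro continuous_intros) auto
        show "isCont (euler m u) ((y - (1 / t) *\<^sub>R y) + (1 / t) *\<^sub>R z)"
          using c(2) by (simp add: continuous_on_eq_continuous_at)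
      qed
      then show "isCont (\<lambda>t. Q t z) t"
        unfolding Q_def shrunk_def
        using t by (intro continuous_intros bounded_bilinear.continuous[OF bounded_bilinear_top_pairing]) auto
    qed
    then show ?thesis
      by (simp add: mult.commute shrunk_def bounded_bilinear.scaleR_right[OF bounded_bilinear_top_pairing])
  qed
  have i1: "integrable lborel (\<lambda>z. top_pairing (w z) (shrunk u \<epsilon> z))"
    by (rule integrable_top_pairing[OF integrable, where C = C]) (simp_all add: shrunk_def C')
  have i2: "integrable lborel (\<lambda>z. top_pairing (w z) (u z))"
    by (rule integrable_top_pairing[OF integrable, where C = C]) (simp_all add: C')
  have "(\<integral>t. indicator {\<epsilon>..1} t * slice (\<lambda>x. interior_product (x - y) (ext_deriv u x)) t \<partial>lborel)
     = (\<integral>t. (\<integral>z. indicator {\<epsilon>..1} t * Q t z \<partial>lborel) \<partial>lborel)"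
  proof (intro Bochner_Integration.integral_cong refl)
    fix t :: real
    show "indicator {\<epsilon>..1} t * slice (\<lambda>x. interior_product (x - y) (ext_deriv u x)) t
      = (\<integral>z. indicator {\<epsilon>..1} t * Q t z \<partial>lborel)"
      using slice_euler[OF u n, of t] \<epsilon> by (cases "t \<in> {\<epsilon>..1}") (auto simp: Q_def)
  qed
  also have "\<dots> = (\<integral>z. (\<integral>t. indicator {\<epsilon>..1} t * Q t z \<partial>lborel) \<partial>lborel)"
    by (rule lborel_pair.Fubini_integral[OF Q_int, symmetric])
  also have "\<dots> = (1 / \<epsilon>) ^ m * (\<integral>z. top_pairing (w z) (shrunk u \<epsilon> z) \<partial>lborel)
      - (\<integral>z. top_pairing (w z) (u z) \<partial>lborel)"
    unfolding inner using i1 i2 by simp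
  finally show ?thesis .
qed

text \<open>
  Substituting back produces the Jacobian \<open>\<epsilon>\<^sup>n\<close> against \<open>\<epsilon>\<close> to the power \<open>-m\<close>, so at least one factor
  \<open>\<epsilon> = 4\<^sup>-\<^sup>i\<close> is left because \<open>n - m = j + 1\<close> is positive. The remaining integral is at most a multiple
  of \<open>2\<^sup>i\<close> by the choice of the base point.
\<close>

lemma shrunk_vanishes:
  assumes u: "test_form m (ball 0 1) u" and n: "CARD('n) = Suc j + m"
  shows "(\<lambda>i. (1 / (1 / 4) ^ i) ^ m * (\<integral>z. top_pairing (w z) (shrunk u ((1 / 4) ^ i) z) \<partial>lborel)) \<longlonglongrightarrow> 0"
proof -
  have [measurable]: "u \<in> borel_measurable borel"
    using test_form_bounds(1)[OF u] by (auto intro: borel_measurable_continuous_onI)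
  obtain C where C: "0 \<le> C" "\<forall>x. norm (u x) \<le> C * indicator (ball 0 1) x \<and>
      norm (euler m u x) \<le> C * indicator (ball 0 1) x \<and>
      norm (ext_deriv (\<lambda>x. interior_product (x - y) (u x)) x) \<le> C * indicator (ball 0 1) x"
    using test_form_bounds(4)[OF u] by blast
  obtain K where K: "0 < K" "\<And>\<alpha> \<beta>. \<bar>top_pairing \<alpha> (\<beta> :: 'n exterior)\<bar> \<le> norm \<alpha> * norm \<beta> * K"
    using top_pairing_bound by blast
  have bound: "\<bar>(1 / (1 / 4) ^ i) ^ m * (\<integral>z. top_pairing (w z) (shrunk u ((1 / 4) ^ i) z) \<partial>lborel)\<bar>
      \<le> (C * K * M) * (1 / 2) ^ i" for i
  proof -
    define \<epsilon> :: real where "\<epsilon> = (1 / 4) ^ i"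
    have \<epsilon>: "0 < \<epsilon>" "\<epsilon> \<le> 1" by (auto simp: \<epsilon>_def power_le_one)
    let ?J = "\<integral>x. top_pairing (w (y + \<epsilon> *\<^sub>R (x - y))) (u x) \<partial>lborel"
    have J: "\<bar>?J\<bar> \<le> C * K * (2 ^ i * M)"
    proof (cases "integrable lborel (\<lambda>x. top_pairing (w (y + \<epsilon> *\<^sub>R (x - y))) (u x))")
      case True
      have "ennreal (norm ?J) \<le> (\<integral>\<^sup>+x. ennreal (norm (top_pairing (w (y + \<epsilon> *\<^sub>R (x - y))) (u x))) \<partial>lborel)"
        by (rule integral_norm_bound_ennreal[OF True])
      also have "\<dots> \<le> (\<integral>\<^sup>+x. ennreal (C * K) * (ennreal (norm (w (y + \<epsilon> *\<^sub>R (x - y)))) * indicator (ball 0 1) x) \<partial>lborel)"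
      proof (intro nn_integral_mono)
        fix x :: "'n space"
        have "norm (top_pairing (w (y + \<epsilon> *\<^sub>R (x - y))) (u x))
            \<le> norm (w (y + \<epsilon> *\<^sub>R (x - y))) * (C * indicator (ball 0 1) x) * K"
          unfolding real_norm_def using K(1) C(2)
          by (intro order_trans[OF K(2)] mult_right_mono mult_left_mono) auto
        then have "norm (top_pairing (w (y + \<epsilon> *\<^sub>R (x - y))) (u x))
            \<le> (C * K) * (norm (w (y + \<epsilon> *\<^sub>R (x - y))) * indicator (ball 0 1) x)"
          by (simp add: mult_ac)
        then show "ennreal (norm (top_pairing (w (y + \<epsilon> *\<^sub>R (x - y))) (u x)))
            \<le> ennreal (C * K) * (ennreal (norm (w (y + \<epsilon> *\<^sub>R (x - y)))) * indicator (ball 0 1) x)"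
          using K(1) C(1) by (subst ennreal_indicator[symmetric]) (simp add: ennreal_mult[symmetric] ennreal_leI)
      qed
      also have "\<dots> = ennreal (C * K) * (\<integral>\<^sup>+x. ennreal (norm (w (y + \<epsilon> *\<^sub>R (x - y)))) * indicator (ball 0 1) x \<partial>lborel)"
        by (rule nn_integral_cmult) measurable
      also have "\<dots> \<le> ennreal (C * K) * ennreal (2 ^ i * M)"
        unfolding \<epsilon>_def by (intro mult_left_mono shrink(2)) simp
      also have "\<dots> = ennreal (C * K * (2 ^ i * M))"
        using C(1) K(1) shrink(1) by (simp add: ennreal_mult)
      finally show ?thesis
        using C(1) K(1) shrink(1) by (simp add: ennreal_le_iff)
    next
      case False
      then show ?thesis using C(1) K(1) shrink(1) by (simp add: not_integrable_integral_eq)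
    qed
    have "(1 / \<epsilon>) ^ m * \<epsilon> ^ CARD('n) = (1 / \<epsilon>) ^ m * \<epsilon> ^ m * (\<epsilon> ^ j * \<epsilon>)"
      by (simp add: n power_add)
    also have "\<dots> = \<epsilon> ^ j * \<epsilon>" using \<epsilon> by (simp add: power_mult_distrib[symmetric])
    finally have "(1 / \<epsilon>) ^ m * (\<integral>z. top_pairing (w z) (shrunk u \<epsilon> z) \<partial>lborel) = \<epsilon> ^ j * \<epsilon> * ?J"
      using integral_shrunk[OF _ \<epsilon>(1), of u] by (simp add: mult.assoc[symmetric])
    then have "\<bar>(1 / \<epsilon>) ^ m * (\<integral>z. top_pairing (w z) (shrunk u \<epsilon> z) \<partial>lborel)\<bar> = \<epsilon> ^ j * \<epsilon> * \<bar>?J\<bar>"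
      using \<epsilon>(1) by (simp add: abs_mult)
    also have "\<dots> \<le> 1 * \<epsilon> * (C * K * (2 ^ i * M))"
      using \<epsilon> J by (intro mult_mono power_le_one) auto
    also have "\<dots> = (C * K * M) * (\<epsilon> * 2 ^ i)" by simp
    also have "\<epsilon> * 2 ^ i = (1 / 2) ^ i"
      by (simp add: \<epsilon>_def power_mult_distrib[symmetric])
    finally show ?thesis by (simp only: \<epsilon>_def)
  qed
  have "(\<lambda>i. (C * K * M) * (1 / 2) ^ i) \<longlonglongrightarrow> 0"
    by (intro tendsto_mult_right_zero LIMSEQ_power_zero) simp
  then show ?thesis
    by (rule Lim_null_comparison[rotated]) (use bound in simp)
qed

text \<open>
  The integral over \<open>[\<epsilon>, 1]\<close> converges to the whole integral by dominated convergence.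
\<close>

lemma integral_slice:
  assumes u: "test_form m (ball 0 1) u" and n: "CARD('n) = Suc j + m"
  shows "(\<integral>t. slice (\<lambda>x. interior_product (x - y) (ext_deriv u x)) t \<partial>unit_interval)
    = - (\<integral>z. top_pairing (w z) (u z) \<partial>lborel)"
proof -
  let ?H = "slice (\<lambda>x. interior_product (x - y) (ext_deriv u x))"
  let ?\<epsilon> = "\<lambda>i::nat. (1 / 4 :: real) ^ i"
  have H: "integrable unit_interval ?H" by (rule integral_cone_primitive(2)[OF u])
  then have H_meas [measurable]: "?H \<in> borel_measurable borel"
    using borel_measurable_integrable[OF H] by (simp cong: measurable_cong_sets)
  have trunc: "(\<integral>t. indicator {?\<epsilon> i..1} t * ?H t \<partial>unit_interval)
      = (1 / ?\<epsilon> i) ^ m * (\<integral>z. top_pairing (w z) (shrunk u (?\<epsilon> i) z) \<partial>lborel)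
        - (\<integral>z. top_pairing (w z) (u z) \<partial>lborel)" for i
  proof -
    have \<epsilon>: "0 < ?\<epsilon> i" "?\<epsilon> i \<le> 1" by (auto simp: power_le_one)
    have "(\<integral>t. indicator {?\<epsilon> i..1} t * ?H t \<partial>unit_interval)
       = (\<integral>t. indicator {0<..1} t *\<^sub>R (indicator {?\<epsilon> i..1} t * ?H t) \<partial>lborel)"
      unfolding unit_interval_def
    proof (rule integral_density)
      show "(\<lambda>t. indicator {?\<epsilon> i..1} t * ?H t) \<in> borel_measurable lborel" by measurable
      show "(\<lambda>t. indicator {0<..1::real} t :: real) \<in> borel_measurable lborel" by measurable
    qed simp
    also have "\<dots> = (\<integral>t. indicator {?\<epsilon> i..1} t * ?H t \<partial>lborel)"
      using less_le_trans[OF \<epsilon>(1)]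
      by (intro Bochner_Integration.integral_cong refl) (auto simp del: zero_less_power split: split_indicator)
    finally show ?thesis using integral_slice_from[OF u n \<epsilon>] by simp
  qed
  have "(\<lambda>i. \<integral>t. indicator {?\<epsilon> i..1} t * ?H t \<partial>unit_interval) \<longlonglongrightarrow> (\<integral>t. ?H t \<partial>unit_interval)"
  proof (rule integral_dominated_convergence[where w = "\<lambda>t. \<bar>?H t\<bar>"])
    show "AE t in unit_interval. (\<lambda>i. indicator {?\<epsilon> i..1} t * ?H t) \<longlonglongrightarrow> ?H t"
    proof (rule eventually_mono[OF AE_unit_interval])
      fix t :: real assume t: "0 < t \<and> t \<le> 1"
      have "?\<epsilon> \<longlonglongrightarrow> 0" by (rule LIMSEQ_power_zero) simp
      then have "\<forall>\<^sub>F i in sequentially. ?\<epsilon> i < t" using t by (auto dest: order_tendstoD)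
      then have "\<forall>\<^sub>F i in sequentially. indicator {?\<epsilon> i..1} t * ?H t = ?H t"
        by (rule eventually_mono) (use t in auto)
      then show "(\<lambda>i. indicator {?\<epsilon> i..1} t * ?H t) \<longlonglongrightarrow> ?H t"
        by (rule tendsto_eventually)
    qed
    show "AE t in unit_interval. norm (indicator {?\<epsilon> i..1} t * ?H t) \<le> \<bar>?H t\<bar>" for i
      by (intro AE_I2) (auto simp: abs_mult split: split_indicator)
  qed (use H in simp_all)
  moreover have "(\<lambda>i. \<integral>t. indicator {?\<epsilon> i..1} t * ?H t \<partial>unit_interval)
      \<longlonglongrightarrow> 0 - (\<integral>z. top_pairing (w z) (u z) \<partial>lborel)"
    unfolding trunc by (intro tendsto_diff shrunk_vanishes[OF u n] tendsto_const)
  ultimately show ?thesis using LIMSEQ_unique by fastforce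
qed

lemma cone_primitive_weak:
  assumes u: "test_form m (ball 0 1) u" and n: "CARD('n) = Suc j + m"
  shows "(\<integral>x. top_pairing (cone_primitive j y w x) (ext_deriv u x) \<partial>lborel)
    = (-1) ^ Suc j * (\<integral>x. top_pairing (w x) (u x) \<partial>lborel)"
  using integral_cone_primitive(1)[OF u] integral_slice[OF u n] by simp

end

section \<open>Forms on the unit ball\<close>

lemma borel_measurable_vec:
  fixes f :: "'a \<Rightarrow> real ^ 'm"
  assumes "\<And>I. (\<lambda>x. f x $ I) \<in> borel_measurable M"
  shows "f \<in> borel_measurable M"
  by (subst borel_measurable_euclidean_space) (auto simp: Basis_vec_def inner_axis assms)

text \<open>
  Joint measurability of \<open>\<omega>(y + t (x - y))\<close> in \<open>t\<close> and \<open>x\<close> is immediate only for Borel functions, so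
  \<open>\<omega>\<close> is replaced by a Borel form of the same degree that agrees with it almost everywhere.
\<close>

lemma borel_representative:
  fixes \<omega> :: "'n::finite form"
  assumes "measurable_form k (ball 0 1) \<omega>"
  shows "\<exists>w\<in>borel_measurable borel. (\<forall>x. w x \<in> exterior_power k) \<and> (\<forall>x. x \<notin> ball 0 1 \<longrightarrow> w x = 0) \<and>
    (AE x in lebesgue. x \<in> ball 0 1 \<longrightarrow> \<omega> x = w x)"
proof -
  let ?B = "ball 0 1 :: 'n space set"
  let ?f = "\<lambda>x. indicator ?B x *\<^sub>R \<omega> x"
  have "?f \<in> borel_measurable lebesgue"
    using assms by (subst borel_measurable_restrict_space_iff[symmetric]) (auto simp: measurable_form_def)
  then have "(\<lambda>x. ?f x $ I) \<in> borel_measurable (completion lborel)" for I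
    by (rule measurable_compose)
      (intro borel_measurable_continuous_onI linear_continuous_on bounded_linear_vec_nth)
  from completion_ex_borel_measurable_real[OF this]
  have "\<forall>I. \<exists>g. g \<in> borel_measurable lborel \<and> (AE x in lborel. ?f x $ I = g x)" by blast
  from choice[OF this] obtain g
    where g: "\<forall>I. g I \<in> borel_measurable lborel \<and> (AE x in lborel. ?f x $ I = g I x)" ..
  have [measurable]: "g I \<in> borel_measurable borel" for I using g by simp
  define w :: "'n form" where
    "w x = (\<chi> I. if x \<in> ?B \<and> card I = k then g I x else 0)" for x
  have "w \<in> borel_measurable borel"
    by (rule borel_measurable_vec) (simp add: w_def, measurable)
  moreover have "w x \<in> exterior_power k" for x by (simp add: w_def exterior_power_def)
  moreover have "w x = 0" if "x \<notin> ?B" for x using that by (simp add: w_def vec_eq_iff)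
  moreover have "AE x in lebesgue. x \<in> ?B \<longrightarrow> \<omega> x = w x"
  proof -
    have "AE x in lborel. \<forall>I. ?f x $ I = g I x" using g by (simp add: AE_all_countable)
    then have "AE x in lborel. x \<in> ?B \<longrightarrow> \<omega> x = w x"
    proof eventually_elim
      case (elim x)
      show ?case
      proof
        assume x: "x \<in> ?B"
        then have "\<omega> x \<in> exterior_power k" using assms by (simp add: measurable_form_def)
        then have "\<omega> x $ I = w x $ I" for I
          using elim x by (simp add: w_def exterior_power_def)
        then show "\<omega> x = w x" by (simp add: vec_eq_iff)
      qed
    qed
    then show ?thesis by (rule AE_completion)
  qed
  ultimately show ?thesis by blast
qed

text \<open>
  All integrals against test forms become integrals of Borel functions over the whole space: the
  second factor vanishes off \<open>U\<close>.
\<close>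

lemma form_integral_representative:
  fixes \<omega> w g :: "'n::{finite,linorder} form"
  assumes \<omega>: "\<omega> \<in> borel_measurable (lebesgue_on (ball 0 1))"
    and w[measurable]: "w \<in> borel_measurable borel"
    and AE: "AE x in lebesgue. x \<in> ball 0 1 \<longrightarrow> \<omega> x = w x"
    and U: "open U" "U \<subseteq> ball 0 1"
    and g[measurable]: "g \<in> borel_measurable borel" and g0: "\<And>x. x \<notin> U \<Longrightarrow> g x = 0"
  shows "form_integral U (\<lambda>x. wedge (\<omega> x) (g x)) = (\<integral>x. top_pairing (w x) (g x) \<partial>lborel)"
proof -
  let ?B = "ball 0 1 :: 'n space set"
  have \<omega>'[measurable]: "(\<lambda>x. indicator ?B x *\<^sub>R \<omega> x) \<in> borel_measurable lebesgue"
    using \<omega> by (subst borel_measurable_restrict_space_iff[symmetric]) auto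
  have [measurable]: "g \<in> borel_measurable lebesgue" "w \<in> borel_measurable lebesgue"
    using g w by (auto intro: measurable_completion)
  have eq: "indicator U x *\<^sub>R top_pairing (\<omega> x) (g x) = top_pairing (indicator ?B x *\<^sub>R \<omega> x) (g x)" for x
    using U(2) g0[of x]
    by (auto split: split_indicator simp: bounded_bilinear.zero_right[OF bounded_bilinear_top_pairing])
  have "form_integral U (\<lambda>x. wedge (\<omega> x) (g x)) = (\<integral>x. indicator U x *\<^sub>R top_pairing (\<omega> x) (g x) \<partial>lebesgue)"
    unfolding form_integral_def top_pairing_def[symmetric]
    using U(1) by (intro integral_restrict_space) auto
  also have "\<dots> = (\<integral>x. top_pairing (w x) (g x) \<partial>lebesgue)"
  proof (rule integral_cong_AE)
    show "AE x in lebesgue. indicator U x *\<^sub>R top_pairing (\<omega> x) (g x) = top_pairing (w x) (g x)"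
      using AE
    proof eventually_elim
      case (elim x)
      then show ?case using U(2) g0[of x]
        by (auto split: split_indicator simp: bounded_bilinear.zero_right[OF bounded_bilinear_top_pairing])
    qed
  qed (unfold eq, measurable)
  also have "\<dots> = (\<integral>x. top_pairing (w x) (g x) \<partial>lborel)"
    by (rule integral_completion) measurable
  finally show ?thesis .
qed

lemma modular_representative:
  assumes N: "N_function \<Phi>" and [measurable]: "w \<in> borel_measurable borel"
    and AE: "AE x in lebesgue. x \<in> ball 0 1 \<longrightarrow> \<omega> x = w x"
  shows "modular \<Phi> (ball 0 1) (\<lambda>x. \<alpha> *\<^sub>R \<omega> x) =
    (\<integral>\<^sup>+x. ennreal (\<Phi> (norm (\<alpha> *\<^sub>R w x))) * indicator (ball 0 1) x \<partial>lborel)"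
proof -
  have [measurable]: "\<Phi> \<in> borel_measurable borel" by (rule N_function_measurable[OF N])
  have "modular \<Phi> (ball 0 1) (\<lambda>x. \<alpha> *\<^sub>R \<omega> x)
      = (\<integral>\<^sup>+x. ennreal (\<Phi> (norm (\<alpha> *\<^sub>R \<omega> x))) * indicator (ball 0 1) x \<partial>lebesgue)"
    unfolding modular_def by (rule nn_integral_restrict_space) simp
  also have "\<dots> = (\<integral>\<^sup>+x. ennreal (\<Phi> (norm (\<alpha> *\<^sub>R w x))) * indicator (ball 0 1) x \<partial>lebesgue)"
    by (rule nn_integral_cong_AE, use AE in eventually_elim) (auto split: split_indicator)
  also have "\<dots> = (\<integral>\<^sup>+x. ennreal (\<Phi> (norm (\<alpha> *\<^sub>R w x))) * indicator (ball 0 1) x \<partial>lborel)"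
    by (rule nn_integral_completion)
  finally show ?thesis .
qed

lemma LPhi_integrable:
  fixes \<omega> :: "'n::finite form"
  assumes N: "N_function \<Phi>" and \<omega>: "\<omega> \<in> LPhi \<Phi> k (ball 0 1)"
  shows "integrable (lebesgue_on (ball 0 1)) \<omega>"
proof (rule integrableI_bounded)
  let ?M = "lebesgue_on (ball 0 1 :: 'n space set)"
  have [measurable]: "\<Phi> \<in> borel_measurable borel" by (rule N_function_measurable[OF N])
  show [measurable]: "\<omega> \<in> borel_measurable ?M"
    using \<omega> by (simp add: LPhi_def measurable_form_def)
  obtain \<alpha> where \<alpha>: "\<alpha> > 0" "modular \<Phi> (ball 0 1) (\<lambda>x. \<alpha> *\<^sub>R \<omega> x) < \<infinity>"
    using \<omega> by (auto simp: LPhi_def)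
  obtain R where R: "0 \<le> R" "\<And>s. 0 \<le> s \<Longrightarrow> s \<le> R + \<Phi> s"
    using N_function_superlinear[OF N] by blast
  have nn: "0 \<le> \<Phi> s" for s by (rule N_function_nonneg[OF N])
  have "(\<integral>\<^sup>+x. ennreal (norm (\<omega> x)) \<partial>?M)
      \<le> (\<integral>\<^sup>+x. ennreal (1 / \<alpha>) * (ennreal R + ennreal (\<Phi> (norm (\<alpha> *\<^sub>R \<omega> x)))) \<partial>?M)"
  proof (intro nn_integral_mono)
    fix x
    have "norm (\<omega> x) \<le> 1 / \<alpha> * (R + \<Phi> (norm (\<alpha> *\<^sub>R \<omega> x)))"
      using R(2)[of "norm (\<alpha> *\<^sub>R \<omega> x)"] \<alpha>(1) by (simp add: field_simps)
    then show "ennreal (norm (\<omega> x)) \<le> ennreal (1 / \<alpha>) * (ennreal R + ennreal (\<Phi> (norm (\<alpha> *\<^sub>R \<omega> x))))"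
      using \<alpha>(1) R(1) nn by (subst ennreal_plus[symmetric]) (simp_all add: ennreal_mult[symmetric] ennreal_leI del: ennreal_plus)
  qed
  also have "\<dots> = ennreal (1 / \<alpha>) * (ennreal R * emeasure ?M (space ?M) + modular \<Phi> (ball 0 1) (\<lambda>x. \<alpha> *\<^sub>R \<omega> x))"
    by (simp add: nn_integral_cmult nn_integral_add modular_def)
  also have "\<dots> < \<infinity>"
    using \<alpha>(2) emeasure_lborel_ball_finite[of "0 :: 'n space" 1]
    by (simp add: ennreal_mult_less_top emeasure_restrict_space)
  finally show "(\<integral>\<^sup>+x. ennreal (norm (\<omega> x)) \<partial>?M) < \<infinity>" .
qed

lemma LPhi_loc_integrable:
  fixes \<omega> :: "'n::finite form"
  assumes N: "N_function \<Phi>" and \<omega>: "\<omega> \<in> LPhi \<Phi> k (ball 0 1)"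
  shows "loc_integrable_form k (ball 0 1) \<omega>"
proof -
  have "set_integrable lebesgue (ball 0 1) \<omega>"
    using LPhi_integrable[OF assms] by (simp add: integrable_restrict_space set_integrable_def)
  then have "\<omega> absolutely_integrable_on K" if "compact K" "K \<subseteq> ball 0 1" for K
    by (rule set_integrable_subset) (use that in \<open>auto intro: lmeasurable_compact fmeasurableD\<close>)
  then show ?thesis using \<omega> by (simp add: loc_integrable_form_def LPhi_def)
qed

lemma LPhi_add:
  assumes N: "N_function \<Phi>" and \<omega>: "\<omega> \<in> LPhi \<Phi> k X" and \<eta>: "\<eta> \<in> LPhi \<Phi> k X"
  shows "(\<lambda>x. \<omega> x + \<eta> x) \<in> LPhi \<Phi> k X"
proof -
  have [measurable]: "\<Phi> \<in> borel_measurable borel" by (rule N_function_measurable[OF N])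
  have [measurable]: "\<omega> \<in> borel_measurable (lebesgue_on X)" "\<eta> \<in> borel_measurable (lebesgue_on X)"
    using \<omega> \<eta> by (simp_all add: LPhi_def measurable_form_def)
  obtain \<alpha> where \<alpha>: "\<alpha> > 0" "modular \<Phi> X (\<lambda>x. \<alpha> *\<^sub>R \<omega> x) < \<infinity>" using \<omega> by (auto simp: LPhi_def)
  obtain \<beta> where \<beta>: "\<beta> > 0" "modular \<Phi> X (\<lambda>x. \<beta> *\<^sub>R \<eta> x) < \<infinity>" using \<eta> by (auto simp: LPhi_def)
  define c where "c = min \<alpha> \<beta> / 2"
  have c: "c > 0" "2 * c \<le> \<alpha>" "2 * c \<le> \<beta>" using \<alpha>(1) \<beta>(1) by (auto simp: c_def)
  have nn: "0 \<le> \<Phi> s" for s by (rule N_function_nonneg[OF N])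
  have "modular \<Phi> X (\<lambda>x. c *\<^sub>R (\<omega> x + \<eta> x))
      \<le> (\<integral>\<^sup>+x. ennreal (\<Phi> (norm (\<alpha> *\<^sub>R \<omega> x))) + ennreal (\<Phi> (norm (\<beta> *\<^sub>R \<eta> x))) \<partial>lebesgue_on X)"
    unfolding modular_def
  proof (intro nn_integral_mono)
    fix x
    have "\<Phi> (norm (c *\<^sub>R (\<omega> x + \<eta> x))) \<le> \<Phi> (norm (2 *\<^sub>R (c *\<^sub>R \<omega> x))) + \<Phi> (norm (2 *\<^sub>R (c *\<^sub>R \<eta> x)))"
      unfolding scaleR_add_right by (rule N_function_norm_add[OF N])
    also have "\<dots> \<le> \<Phi> (norm (\<alpha> *\<^sub>R \<omega> x)) + \<Phi> (norm (\<beta> *\<^sub>R \<eta> x))"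
      using c \<alpha>(1) \<beta>(1) by (intro add_mono N_function_mono[OF N]) (auto intro!: mult_right_mono)
    finally show "ennreal (\<Phi> (norm (c *\<^sub>R (\<omega> x + \<eta> x))))
        \<le> ennreal (\<Phi> (norm (\<alpha> *\<^sub>R \<omega> x))) + ennreal (\<Phi> (norm (\<beta> *\<^sub>R \<eta> x)))"
      using nn by (simp add: ennreal_leI ennreal_plus[symmetric] del: ennreal_plus)
  qed
  also have "\<dots> = modular \<Phi> X (\<lambda>x. \<alpha> *\<^sub>R \<omega> x) + modular \<Phi> X (\<lambda>x. \<beta> *\<^sub>R \<eta> x)"
    unfolding modular_def by (rule nn_integral_add) measurable
  also have "\<dots> < \<infinity>" using \<alpha>(2) \<beta>(2) by simp
  finally have "\<exists>\<alpha>>0. modular \<Phi> X (\<lambda>x. \<alpha> *\<^sub>R (\<omega> x + \<eta> x)) < \<infinity>" using c(1) by blast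
  moreover have "measurable_form k X (\<lambda>x. \<omega> x + \<eta> x)"
    using \<omega> \<eta> by (auto simp: LPhi_def measurable_form_def intro: subspace_add[OF subspace_exterior_power])
  ultimately show ?thesis by (simp add: LPhi_def)
qed

lemma LPhi_uminus:
  assumes "\<omega> \<in> LPhi \<Phi> k X"
  shows "(\<lambda>x. - \<omega> x) \<in> LPhi \<Phi> k X"
  using assms by (auto simp: LPhi_def measurable_form_def modular_def intro: subspace_neg[OF subspace_exterior_power])

lemma LPhi_zero:
  assumes "N_function \<Phi>"
  shows "(\<lambda>x. 0) \<in> LPhi \<Phi> k X"
  using N_function_zero[OF assms]
  by (auto simp: LPhi_def measurable_form_def modular_def intro: subspace_0[OF subspace_exterior_power] exI[of _ 1])

lemma loc_integrable_zero: "loc_integrable_form k X (\<lambda>x. 0)"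
  by (auto simp: loc_integrable_form_def measurable_form_def intro: subspace_0[OF subspace_exterior_power])

lemma form_integral_wedge_zero: "form_integral U (\<lambda>x. wedge 0 (u x)) = 0"
  by (simp add: form_integral_def bounded_bilinear.zero_left[OF bounded_bilinear_wedge])

lemma ZPhi_ball_iff:
  fixes \<omega> :: "'n::{finite,linorder} form"
  assumes N: "N_function \<Phi>"
  shows "\<omega> \<in> ZPhi \<Phi> k (ball 0 1) \<longleftrightarrow> \<omega> \<in> LPhi \<Phi> k (ball 0 1) \<and>
    (\<forall>U m u. open U \<and> connected U \<and> U \<subseteq> ball 0 1 \<and> k + 1 + m = CARD('n) \<and> test_form m U u \<longrightarrow>
      form_integral U (\<lambda>x. wedge (\<omega> x) (ext_deriv u x)) = 0)"
  using LPhi_loc_integrable[OF N]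
  by (auto simp: ZPhi_def weak_diff_def loc_integrable_zero form_integral_wedge_zero)

lemma test_form_ext_deriv_properties:
  fixes u :: "'n::{finite,linorder} form"
  assumes "test_form m U u"
  shows "u \<in> borel_measurable borel" "ext_deriv u \<in> borel_measurable borel"
    "\<And>x. x \<notin> U \<Longrightarrow> u x = 0" "\<And>x. x \<notin> U \<Longrightarrow> ext_deriv u x = 0" "\<exists>C. \<forall>x. norm (ext_deriv u x) \<le> C"
proof -
  have c: "continuous_on UNIV u" "continuous_on UNIV (ext_deriv u)"
    using test_form_smooth[OF assms] by (auto intro: smooth_continuous smooth_ext_deriv)
  then show "u \<in> borel_measurable borel" "ext_deriv u \<in> borel_measurable borel"
    by (auto intro: borel_measurable_continuous_onI)
  obtain K where K: "compact K" "K \<subseteq> U" "\<And>x. x \<notin> K \<Longrightarrow> u x = 0"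
      "\<And>x v. x \<notin> K \<Longrightarrow> frechet_derivative u (at x) v = 0" "\<And>x. x \<notin> K \<Longrightarrow> ext_deriv u x = 0"
    using test_form_compact_support[OF assms] by metis
  then show "\<And>x. x \<notin> U \<Longrightarrow> u x = 0" "\<And>x. x \<notin> U \<Longrightarrow> ext_deriv u x = 0" by blast+
  obtain C where C: "\<And>x. norm (ext_deriv u x) \<le> C * indicator UNIV x"
    using bounded_of_compact_support[OF c(2) K(1) subset_UNIV K(5)] by metis
  then show "\<exists>C. \<forall>x. norm (ext_deriv u x) \<le> C" by auto
qed

lemma form_integral_add:
  fixes \<omega> \<eta> :: "'n::{finite,linorder} form"
  assumes \<omega>: "integrable (lebesgue_on (ball 0 1)) \<omega>" and \<eta>: "integrable (lebesgue_on (ball 0 1)) \<eta>"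
    and U: "open U" "U \<subseteq> ball 0 1" and u: "test_form m U u"
  shows "form_integral U (\<lambda>x. wedge (\<omega> x + \<eta> x) (ext_deriv u x)) =
    form_integral U (\<lambda>x. wedge (\<omega> x) (ext_deriv u x)) + form_integral U (\<lambda>x. wedge (\<eta> x) (ext_deriv u x))"
proof -
  have res: "integrable (lebesgue_on U) \<theta>" if "integrable (lebesgue_on (ball 0 1)) \<theta>" for \<theta> :: "'n form"
  proof -
    have "set_integrable lebesgue (ball 0 1) \<theta>"
      using that by (simp add: integrable_restrict_space set_integrable_def)
    then have "set_integrable lebesgue U \<theta>"
      by (rule set_integrable_subset) (use U in auto)
    then show ?thesis using U(1) by (simp add: integrable_restrict_space set_integrable_def)
  qed
  obtain C where C: "\<And>x. norm (ext_deriv u x) \<le> C"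
    using test_form_ext_deriv_properties(5)[OF u] by blast
  have m: "ext_deriv u \<in> borel_measurable (lebesgue_on U)"
    using test_form_ext_deriv_properties(2)[OF u] by (auto intro!: measurable_restrict_space1 measurable_completion)
  have int: "integrable (lebesgue_on U) (\<lambda>x. wedge (\<theta> x) (ext_deriv u x) $ UNIV)"
    if "integrable (lebesgue_on (ball 0 1)) \<theta>" for \<theta> :: "'n form"
    using integrable_top_pairing[OF res[OF that] m C] by (simp add: top_pairing_def)
  show ?thesis
    using int[OF \<omega>] int[OF \<eta>]
    by (simp add: form_integral_def bounded_bilinear.add_left[OF bounded_bilinear_wedge])
qed

text \<open>
  The differential of a test form is a test form one degree higher, so the definition of the weak
  differential applies to it, and \<open>ddu = 0\<close>.
\<close>

lemma BPhi_subset_ZPhi: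
  fixes \<omega> :: "'n::{finite,linorder} form"
  assumes N: "N_function \<Phi>" and \<omega>: "\<omega> \<in> BPhi \<Phi> (Suc j) (ball 0 1)"
  shows "\<omega> \<in> ZPhi \<Phi> (Suc j) (ball 0 1)"
proof -
  obtain \<beta> where \<beta>: "weak_diff j (ball 0 1) \<beta> \<omega>" and L: "\<omega> \<in> LPhi \<Phi> (Suc j) (ball 0 1)"
    using \<omega> by auto
  have W: "\<forall>U m u. open U \<and> connected U \<and> U \<subseteq> interior (ball 0 1) \<and> j + 1 + m = CARD('n) \<and> test_form m U u \<longrightarrow>
      form_integral U (\<lambda>x. wedge (\<beta> x) (ext_deriv u x)) = (-1) ^ (j + 1) * form_integral U (\<lambda>x. wedge (\<omega> x) (u x))"
    using \<beta> unfolding weak_diff_def by (elim conjE)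
  have "form_integral U (\<lambda>x. wedge (\<omega> x) (ext_deriv u x)) = 0"
    if U: "open U" "connected U" "U \<subseteq> ball 0 1" and m: "Suc j + 1 + m = CARD('n)" and u: "test_form m U u"
    for U m and u :: "'n form"
  proof -
    have "form_integral U (\<lambda>x. wedge (\<beta> x) (ext_deriv (ext_deriv u) x)) =
        (-1) ^ (j + 1) * form_integral U (\<lambda>x. wedge (\<omega> x) (ext_deriv u x))"
      using W[rule_format, of U "Suc m" "ext_deriv u"] U m test_form_ext_deriv[OF u]
      by (simp add: interior_open)
    moreover have "form_integral U (\<lambda>x. wedge (\<beta> x) (ext_deriv (ext_deriv u) x)) = 0"
      by (simp add: ext_deriv_ext_deriv[OF test_form_smooth[OF u]] form_integral_def
        bounded_bilinear.zero_right[OF bounded_bilinear_wedge])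
    ultimately show ?thesis by simp
  qed
  then show ?thesis unfolding ZPhi_ball_iff[OF N] using L by blast
qed

text \<open>
  The Poincare lemma for Orlicz spaces on the ball. The vertex of the cone is chosen for the function
  \<open>\<Phi>(\<alpha>|w|) + |w|\<close>: its first summand controls the modular of the primitive, its second one the
  absolute convergence of the integrals in the weak identity.
\<close>

lemma ZPhi_subset_BPhi:
  fixes \<omega> :: "'n::{finite,linorder} form"
  assumes N: "N_function \<Phi>" and \<omega>: "\<omega> \<in> ZPhi \<Phi> (Suc j) (ball 0 1)"
  shows "\<omega> \<in> BPhi \<Phi> (Suc j) (ball 0 1)"
proof -
  let ?B = "ball 0 1 :: 'n space set"
  have L: "\<omega> \<in> LPhi \<Phi> (Suc j) ?B" and Z: "\<And>U m u. open U \<Longrightarrow> connected U \<Longrightarrow> U \<subseteq> ?B \<Longrightarrow>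
      Suc j + 1 + m = CARD('n) \<Longrightarrow> test_form m U u \<Longrightarrow> form_integral U (\<lambda>x. wedge (\<omega> x) (ext_deriv u x)) = 0"
    using \<omega> unfolding ZPhi_ball_iff[OF N] by blast+
  have \<omega>_form: "measurable_form (Suc j) ?B \<omega>" using L by (simp add: LPhi_def)
  then have \<omega>_meas: "\<omega> \<in> borel_measurable (lebesgue_on ?B)" by (simp add: measurable_form_def)
  obtain w where w[measurable]: "w \<in> borel_measurable borel" and w_deg: "\<And>x. w x \<in> exterior_power (Suc j)"
    and w0: "\<And>x. x \<notin> ?B \<Longrightarrow> w x = 0" and AE: "AE x in lebesgue. x \<in> ?B \<longrightarrow> \<omega> x = w x"
    using borel_representative[OF \<omega>_form] by blast
  note rep = form_integral_representative[OF \<omega>_meas w AE]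
  have [measurable]: "\<Phi> \<in> borel_measurable borel" by (rule N_function_measurable[OF N])
  obtain \<alpha> where \<alpha>: "\<alpha> > 0" "modular \<Phi> ?B (\<lambda>x. \<alpha> *\<^sub>R \<omega> x) < \<infinity>"
    using L by (auto simp: LPhi_def)
  have \<Phi>_fin: "(\<integral>\<^sup>+x. ennreal (\<Phi> (\<alpha> * norm (w x))) \<partial>lborel) < \<infinity>"
  proof -
    have "(\<integral>\<^sup>+x. ennreal (\<Phi> (\<alpha> * norm (w x))) \<partial>lborel)
        = (\<integral>\<^sup>+x. ennreal (\<Phi> (norm (\<alpha> *\<^sub>R w x))) * indicator ?B x \<partial>lborel)"
      using \<alpha>(1) w0 N_function_zero[OF N] by (intro nn_integral_cong) (auto split: split_indicator)
    then show ?thesis using \<alpha>(2) unfolding modular_representative[OF N w AE] by simp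
  qed
  have w_int: "integrable lborel w"
  proof -
    have "integrable lebesgue (\<lambda>x. indicator ?B x *\<^sub>R \<omega> x)"
      using LPhi_integrable[OF N L] by (simp add: integrable_restrict_space)
    moreover have "AE x in lebesgue. indicator ?B x *\<^sub>R \<omega> x = w x"
      using AE by eventually_elim (auto simp: w0 split: split_indicator)
    ultimately have "integrable lebesgue w"
      using measurable_completion[of w lborel borel] by (subst integrable_cong_AE[symmetric]) auto
    then show ?thesis by (simp add: integrable_completion)
  qed
  \<comment> \<open>one vertex has to serve the modular and the integrability of \<open>w\<close> at the same time\<close>
  define F where "F x = ennreal (\<Phi> (\<alpha> * norm (w x))) + ennreal (norm (w x))" for x
  have F[measurable]: "F \<in> borel_measurable borel" unfolding F_def by measurable
  have F_fin: "(\<integral>\<^sup>+x. F x \<partial>lborel) < \<infinity>"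
    unfolding F_def using \<Phi>_fin w_int by (simp add: nn_integral_add integrable_iff_bounded)
  have "emeasure lborel ?B \<noteq> 0"
    using content_ball_pos[of 1 "0 :: 'n space"] by (auto simp: measure_def)
  moreover have "emeasure lborel ?B < \<infinity>" by (rule emeasure_lborel_ball_finite)
  ultimately obtain y M where y: "y \<in> ?B"
    and y1: "(\<integral>\<^sup>+t. (\<integral>\<^sup>+x. F (y + t *\<^sub>R (x - y)) * indicator ?B x \<partial>lborel) \<partial>unit_interval) < \<infinity>"
    and M: "0 \<le> M" "\<And>i. (\<integral>\<^sup>+x. F (y + (1 / 4) ^ i *\<^sub>R (x - y)) * indicator ?B x \<partial>lborel) \<le> ennreal (2 ^ i * M)"
    using exists_good_base_point[OF F F_fin unit_ball_borel] by blast
  interpret closed_form_at_base_point w j y M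
  proof
    show "(\<integral>\<^sup>+t. (\<integral>\<^sup>+x. ennreal (norm (w (y + t *\<^sub>R (x - y)))) * indicator ?B x \<partial>lborel) \<partial>unit_interval) < \<infinity>"
      by (rule le_less_trans[OF _ y1]) (auto intro!: nn_integral_mono mult_right_mono simp: F_def)
    show "(\<integral>\<^sup>+x. ennreal (norm (w (y + (1 / 4) ^ i *\<^sub>R (x - y)))) * indicator ?B x \<partial>lborel) \<le> ennreal (2 ^ i * M)" for i
      by (rule order_trans[OF _ M(2)]) (auto intro!: nn_integral_mono mult_right_mono simp: F_def)
    show "(\<integral>x. top_pairing (w x) (ext_deriv v x) \<partial>lborel) = 0"
      if v: "test_form m ?B v" and m: "j + 2 + m = CARD('n)" for m v
      using Z[of ?B m v] rep[of ?B "ext_deriv v"] test_form_ext_deriv_properties(2,4)[OF v] v m by simp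
  qed (fact w_deg w_int y M(1))+
  define \<beta> where "\<beta> = cone_primitive j y w"
  have \<beta>_meas: "\<beta> \<in> borel_measurable borel"
    unfolding \<beta>_def by (rule cone_primitive_measurable[OF w])
  then have \<beta>_meas': "\<beta> \<in> borel_measurable (lebesgue_on ?B)"
    by (auto intro!: measurable_restrict_space1 measurable_completion)
  have \<beta>_form: "measurable_form j ?B \<beta>"
    using \<beta>_meas' cone_primitive_degree[of w j j y, OF w_deg] by (simp add: measurable_form_def \<beta>_def)
  have "(\<integral>\<^sup>+t. (\<integral>\<^sup>+x. ennreal (\<Phi> (\<alpha> * norm (w (y + t *\<^sub>R (x - y))))) * indicator ?B x \<partial>lborel) \<partial>unit_interval) < \<infinity>"
    by (rule le_less_trans[OF _ y1]) (auto intro!: nn_integral_mono mult_right_mono simp: F_def)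
  from cone_primitive_modular[OF N w \<alpha>(1) y this, of j]
  obtain c where "c > 0"
    "(\<integral>\<^sup>+x. ennreal (\<Phi> (norm (c *\<^sub>R \<beta> x))) * indicator ?B x \<partial>lborel) < \<infinity>"
    unfolding \<beta>_def by blast
  moreover have "modular \<Phi> ?B (\<lambda>x. c *\<^sub>R \<beta> x) =
      (\<integral>\<^sup>+x. ennreal (\<Phi> (norm (c *\<^sub>R \<beta> x))) * indicator ?B x \<partial>lborel)"
    by (rule modular_representative[OF N \<beta>_meas]) simp
  ultimately have "\<exists>c>0. modular \<Phi> ?B (\<lambda>x. c *\<^sub>R \<beta> x) < \<infinity>" by auto
  with \<beta>_form have \<beta>_L: "\<beta> \<in> LPhi \<Phi> j ?B" by (simp add: LPhi_def)
  have "form_integral U (\<lambda>x. wedge (\<beta> x) (ext_deriv u x)) =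
      (-1) ^ (j + 1) * form_integral U (\<lambda>x. wedge (\<omega> x) (u x))"
    if U: "open U" "U \<subseteq> ?B" and m: "j + 1 + m = CARD('n)" and u: "test_form m U u" for U m and u :: "'n form"
  proof -
    note p = test_form_ext_deriv_properties[OF u]
    have "form_integral U (\<lambda>x. wedge (\<beta> x) (ext_deriv u x)) = (\<integral>x. top_pairing (\<beta> x) (ext_deriv u x) \<partial>lborel)"
      by (rule form_integral_representative[OF \<beta>_meas' \<beta>_meas _ U p(2,4)]) auto
    also have "\<dots> = (-1) ^ Suc j * (\<integral>x. top_pairing (w x) (u x) \<partial>lborel)"
      unfolding \<beta>_def using cone_primitive_weak[OF test_form_mono[OF u U(2)]] m by simp
    also have "(\<integral>x. top_pairing (w x) (u x) \<partial>lborel) = form_integral U (\<lambda>x. wedge (\<omega> x) (u x))"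
      by (rule rep[OF U p(1,3), symmetric])
    finally show ?thesis by simp
  qed
  then have "weak_diff j ?B \<beta> \<omega>"
    unfolding weak_diff_def
    using LPhi_loc_integrable[OF N \<beta>_L] LPhi_loc_integrable[OF N L] by (auto simp: interior_open)
  with L \<beta>_L show ?thesis by auto
qed

section \<open>The cohomology group\<close>

lemma comm_group_ZPhi:
  assumes N: "N_function \<Phi>"
  shows "comm_group (ZPhi_group \<Phi> k (ball 0 1 :: 'n::{finite,linorder} space set))"
proof -
  let ?Z = "ZPhi \<Phi> k (ball 0 1 :: 'n space set)"
  have zero: "(\<lambda>x. 0) \<in> ?Z"
    unfolding ZPhi_ball_iff[OF N] using LPhi_zero[OF N] by (simp add: form_integral_wedge_zero)
  have add: "(\<lambda>x. \<omega> x + \<eta> x) \<in> ?Z" if "\<omega> \<in> ?Z" "\<eta> \<in> ?Z" for \<omega> \<eta>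
  proof -
    from that have L: "\<omega> \<in> LPhi \<Phi> k (ball 0 1)" "\<eta> \<in> LPhi \<Phi> k (ball 0 1)" by (simp_all add: ZPhi_def)
    note i = L[THEN LPhi_integrable[OF N]]
    show ?thesis
      using that LPhi_add[OF N L] form_integral_add[OF i] unfolding ZPhi_ball_iff[OF N] by auto
  qed
  have neg: "(\<lambda>x. - \<omega> x) \<in> ?Z" if "\<omega> \<in> ?Z" for \<omega>
    using that LPhi_uminus unfolding ZPhi_ball_iff[OF N]
    by (auto simp: form_integral_def bounded_bilinear.minus_left[OF bounded_bilinear_wedge])
  let ?G = "ZPhi_group \<Phi> k (ball 0 1 :: 'n space set)"
  show ?thesis
  proof (rule comm_groupI)
    show "\<exists>y\<in>carrier ?G. y \<otimes>\<^bsub>?G\<^esub> x = \<one>\<^bsub>?G\<^esub>" if "x \<in> carrier ?G" for x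
      using that neg[of x] by (intro bexI[of _ "\<lambda>z. - x z"]) (simp_all add: ZPhi_group_def)
    show "x \<otimes>\<^bsub>?G\<^esub> y \<in> carrier ?G" if "x \<in> carrier ?G" "y \<in> carrier ?G" for x y
      using that add[of x y] by (simp add: ZPhi_group_def)
  qed (use zero in \<open>simp_all add: ZPhi_group_def add_ac\<close>)
qed

lemma (in comm_group) trivial_group_quotient_by_carrier: "trivial_group (G Mod carrier G)"
proof -
  have "carrier G \<lhd> G" by (rule subgroup_imp_normal[OF subgroup_self])
  then interpret Q: group "G Mod carrier G" by (rule normal.factorgroup_is_group)
  have "carrier G #> a = carrier G" if "a \<in> carrier G" for a
    by (rule coset_join2[OF that subgroup_self that])
  then have "carrier (G Mod carrier G) \<subseteq> {carrier G}"
    by (auto simp: FactGroup_def RCOSETS_def)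
  then show ?thesis using Q.trivial_group_alt by blast
qed

theorem theorem6p4:
  fixes \<Phi> :: "real \<Rightarrow> real" and k :: nat
  assumes "N_function \<Phi>"
    and "k \<in> {1..CARD('n)}"
  shows "trivial_group (HPhi \<Phi> k (ball 0 1 :: (real ^ 'n::{finite,linorder}) set))"
proof -
  let ?B = "ball 0 1 :: 'n space set"
  obtain j where k: "k = Suc j" using assms(2) by (cases k) auto
  have "BPhi \<Phi> k ?B = ZPhi \<Phi> k ?B"
    unfolding k using BPhi_subset_ZPhi[OF assms(1)] ZPhi_subset_BPhi[OF assms(1)] by blast
  then have eq: "HPhi \<Phi> k ?B = ZPhi_group \<Phi> k ?B Mod carrier (ZPhi_group \<Phi> k ?B)"
    by (simp add: HPhi_def ZPhi_group_def)
  show ?thesis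
    unfolding eq by (rule comm_group.trivial_group_quotient_by_carrier[OF comm_group_ZPhi[OF assms(1)]])
qed

end
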